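(* Let $X'_{(i)}:=-\log(1-F(X_{(i)}))$, $i=0,\ldots,n+1$, and define $\mathbf{W}'=(W'_i)_{i=0}^{n+1}$ by $$W'_i:=\sum_{k=1}^iD'_k\Big/\sum_{k=1}^{n+1}D'_k,\qquad D'_i:=(n-i+2)(X'_{(i)}-X'_{(i-1)}).$$ Then $\mathbf{W}'=_{\mathcal{L}}\mathbf{U}$ (equality in distribution) and, for arbitrary integers $0\le j<k\le n+1$ with $k-j>1$, $$T_{jk}(\mathbf{W})\begin{cases}\ge T_{jk}(\mathbf{W}'),&\text{if the failure rate of } f\text{ is nondecreasing on }\mathcal{I}_{jk},\\ \le T_{jk}(\mathbf{W}'),&\text{if the failure rate of } f\text{ is nonincreasing on }\mathcal{I}_{jk}.\end{cases}$$
   Context: $F$ is a distribution function with Lebesgue density $f$ on $(0,\infty)$; its failure rate is $f/(1-F)$. $X_{(0)}<X_{(1)}<\cdots<X_{(n+1)}$ are the order statistics of $n+2$ i.i.d. observations from $F$, or else $X_{(1)}<\cdots<X_{(n+1)}$ are the order statistics of $n+1$ i.i.d. observations from $F$ and $X_{(0)}$ is the left endpoint of the support of $F$. Write $\mathcal{I}_{jk}:=(X_{(j)},X_{(k)})$. The normalized spacings are $D_i:=(n-i+2)(X_{(i)}-X_{(i-1)})$, $i=1,\ldots,n+1$, and $\mathbf{W}=(W_i)_{i=0}^{n+1}$ with $W_i:=\sum_{k=1}^iD_k/\sum_{k=1}^{n+1}D_k$ (so $W_0=0$). $\mathbf{U}=(U_{(i)})_{i=0}^{n+1}$ has $U_{(0)}=0$,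 $U_{(n+1)}=1$ and $U_{(1)}<\cdots<U_{(n)}$ distributed as the order statistics of $n$ independent uniform random variables on $[0,1]$. With $\beta(x):=1\{x\in(0,1)\}(2x-1)$, for a vector $\mathbf{V}=(V_i)_{i=0}^{n+1}$ with strictly increasing components and $k-j>1$, $$T_{jk}(\mathbf{V}):=\sum_{i=j+1}^{k-1}\beta\left(\frac{V_i-V_j}{V_k-V_j}\right).$$ *)

theory Defs
  imports "HOL-Probability.Probability"
begin

text \<open>A density on (0,\<infinity>) is extended by 0 to the real line, and F is the distribution function
  of the resulting probability measure.\<close>

definition df_with_density :: "(real \<Rightarrow> real) \<Rightarrow> (real \<Rightarrow> real) \<Rightarrow> bool" where
  "df_with_density F f \<longleftrightarrow>
     f \<in> borel_measurable borel \<and> (\<forall>x. 0 \<le> f x) \<and> (\<forall>x\<le>0. f x = 0) \<and>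
     prob_space (density lborel (\<lambda>x. ennreal (f x))) \<and>
     F = cdf (density lborel (\<lambda>x. ennreal (f x)))"

definition failure_rate :: "(real \<Rightarrow> real) \<Rightarrow> (real \<Rightarrow> real) \<Rightarrow> real \<Rightarrow> real" where
  "failure_rate F f x = f x / (1 - F x)"

text \<open>The support consists of the points of increase of F. If F is concentrated on (0,\<infinity>), this set
  is nonempty and bounded below by 0, so its infimum is a genuine one.\<close>

definition df_support :: "(real \<Rightarrow> real) \<Rightarrow> real set" where
  "df_support F = {x. \<forall>e>0. F (x - e) < F (x + e)}"

definition left_endpoint :: "(real \<Rightarrow> real) \<Rightarrow> real" where
  "left_endpoint F = Inf (df_support F)"

definition iid_sample :: "'a measure \<Rightarrow> nat \<Rightarrow> real measure \<Rightarrow> (nat \<Rightarrow> 'a \<Rightarrow> real) \<Rightarrow> bool" where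
  "iid_sample M m \<mu> Y \<longleftrightarrow>
     prob_space.indep_vars M (\<lambda>_. borel) Y {..<m} \<and> (\<forall>i<m. distr M borel (Y i) = \<mu>)"

text \<open>The index starts at 0: \<open>order_stat m Y 0\<close> is the minimum of the m observations.\<close>

definition order_stat :: "nat \<Rightarrow> (nat \<Rightarrow> 'a \<Rightarrow> real) \<Rightarrow> nat \<Rightarrow> 'a \<Rightarrow> real" where
  "order_stat m Y i \<omega> = sort (map (\<lambda>l. Y l \<omega>) [0..<m]) ! i"

text \<open>The two sampling schemes: \<open>X i\<close> stands for \<open>X\<^sub>(\<^sub>i\<^sub>)\<close>, for \<open>i \<le> n + 1\<close>.\<close>

definition full_order_statistics ::
  "'a measure \<Rightarrow> nat \<Rightarrow> (real \<Rightarrow> real) \<Rightarrow> (nat \<Rightarrow> 'a \<Rightarrow> real) \<Rightarrow> bool" where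
  "full_order_statistics M n f X \<longleftrightarrow>
     (\<exists>Y. iid_sample M (n + 2) (density lborel (\<lambda>x. ennreal (f x))) Y \<and>
          (\<forall>\<omega>\<in>space M. \<forall>i\<le>n + 1. X i \<omega> = order_stat (n + 2) Y i \<omega>))"

definition endpoint_order_statistics ::
  "'a measure \<Rightarrow> nat \<Rightarrow> (real \<Rightarrow> real) \<Rightarrow> (real \<Rightarrow> real) \<Rightarrow> (nat \<Rightarrow> 'a \<Rightarrow> real) \<Rightarrow> bool" where
  "endpoint_order_statistics M n F f X \<longleftrightarrow>
     (\<exists>Y. iid_sample M (n + 1) (density lborel (\<lambda>x. ennreal (f x))) Y \<and>
          (\<forall>\<omega>\<in>space M. X 0 \<omega> = left_endpoint F \<and>
             (\<forall>i\<in>{1..n + 1}. X i \<omega> = order_stat (n + 1) Y (i - 1) \<omega>)))"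

definition uniform_order_vector ::
  "'b measure \<Rightarrow> nat \<Rightarrow> (nat \<Rightarrow> 'b \<Rightarrow> real) \<Rightarrow> bool" where
  "uniform_order_vector N n U \<longleftrightarrow>
     (\<exists>V. iid_sample N n (uniform_measure lborel {0..1}) V \<and>
          (\<forall>\<omega>\<in>space N. U 0 \<omega> = 0 \<and> U (n + 1) \<omega> = 1 \<and>
             (\<forall>i\<in>{1..n}. U i \<omega> = order_stat n V (i - 1) \<omega>)))"

definition norm_spacing :: "nat \<Rightarrow> (nat \<Rightarrow> real) \<Rightarrow> nat \<Rightarrow> real" where
  "norm_spacing n x i = (real n - real i + 2) * (x i - x (i - 1))"

definition norm_spacing_ratio :: "nat \<Rightarrow> (nat \<Rightarrow> real) \<Rightarrow> nat \<Rightarrow> real" where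
  "norm_spacing_ratio n x i =
     (\<Sum>k=1..i. norm_spacing n x k) / (\<Sum>k=1..n + 1. norm_spacing n x k)"

definition beta_fun :: "real \<Rightarrow> real" where
  "beta_fun x = indicator {0<..<1} x * (2 * x - 1)"

definition T_stat :: "nat \<Rightarrow> nat \<Rightarrow> (nat \<Rightarrow> real) \<Rightarrow> real" where
  "T_stat j k v = (\<Sum>i=j + 1..k - 1. beta_fun ((v i - v j) / (v k - v j)))"

text \<open>Equality in law of random vectors with index set I, possibly on different probability
  spaces. Measurability is required because \<open>distr\<close> is meaningless for nonmeasurable maps.\<close>

definition eq_in_law ::
  "'i set \<Rightarrow> 'a measure \<Rightarrow> ('i \<Rightarrow> 'a \<Rightarrow> real) \<Rightarrow> 'b measure \<Rightarrow> ('i \<Rightarrow> 'b \<Rightarrow> real) \<Rightarrow> bool" where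
  "eq_in_law I M X N Y \<longleftrightarrow>
     (\<forall>i\<in>I. X i \<in> borel_measurable M) \<and> (\<forall>i\<in>I. Y i \<in> borel_measurable N) \<and>
     distr M (PiM I (\<lambda>_. borel)) (\<lambda>\<omega>. \<lambda>i\<in>I. X i \<omega>) =
     distr N (PiM I (\<lambda>_. borel)) (\<lambda>\<omega>. \<lambda>i\<in>I. Y i \<omega>)"

end

theory Submission
  imports Defs
begin

text \<open>Write \<open>H = - ln (1 - F)\<close> for the cumulative hazard. Two independent facts carry the proof.

The law of \<open>W'\<close>. As F is continuous, H turns the observations into standard exponential ones, and it
respects their order as long as \<open>F < 1\<close>, so \<open>X'\<close> consists of exponential order statistics. In the
second sampling scheme \<open>X'\<close> starts at 0, because F vanishes at the left endpoint of its support. The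
joint density of a sorted sample of size m is m! times the product density on the chamber
\<open>x\<^sub>0 \<le> x\<^sub>1 \<le> \<dots>\<close> (\<open>nn_integral_sort_vec\<close>). A triangular linear change of variables on this chamber
shows that the normalized spacings of an exponential sample are again independent standard
exponentials (\<open>distr_spacing_sort_vec_exp\<close>), the first one being a multiple of
the minimum. A second such
change of variables, followed by a rescaling with the last partial sum, shows that the partial sums
of n + 1 independent exponentials, divided by the last of them, are distributed like n ordered
uniform variables (\<open>distr_partial_sum_ratios_exp\<close>).

The inequalities. They hold for every outcome in which \<open>F < 1\<close> at all order statistics and all
\<open>D'\<^sub>i\<close> are positive, which is almost every outcome. The quotient \<open>D'\<^sub>i / D\<^sub>i\<close> is the slope of H
between \<open>X\<^sub>i\<^sub>-\<^sub>1\<close> and \<open>X\<^sub>i\<close>, and H is an integral of the failure rate. If the failure rate is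
nondecreasing between \<open>X\<^sub>j\<close> and \<open>X\<^sub>k\<close>, then H is convex there and these slopes increase with i.
Thus \<open>D'\<close> puts relatively more mass than D on late indices, each fraction
\<open>(W'\<^sub>i - W'\<^sub>j) / (W'\<^sub>k - W'\<^sub>j)\<close> is at most the corresponding fraction for W, and T is a sum of increasing
functions of these fractions. For a nonincreasing failure rate, D and \<open>D'\<close> exchange roles.\<close>

section \<open>Lebesgue integrals over finite products\<close>

lemma sets_PiM_eq_borel:
  "sets \<mu> = sets borel \<Longrightarrow> sets (PiM I (\<lambda>_. \<mu>)) = sets (PiM I (\<lambda>_. borel))"
  by (intro sets_PiM_cong) auto

interpretation lborel_PiM: product_sigma_finite "\<lambda>_::nat. lborel :: real measure"
  by standard

lemma PiM_density_lborel:
  fixes p :: "real \<Rightarrow> ennreal"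
  assumes I: "finite I" and p[measurable]: "p \<in> borel_measurable borel"
    and prob: "prob_space (density lborel p)"
  shows "PiM I (\<lambda>_::nat. density lborel p) = density (PiM I (\<lambda>_. lborel)) (\<lambda>x. \<Prod>i\<in>I. p (x i))"
proof -
  interpret P: prob_space "density lborel p" by fact
  interpret product_sigma_finite "\<lambda>_::nat. density lborel p" by standard
  have "density (PiM I (\<lambda>_. lborel)) (\<lambda>x. \<Prod>i\<in>I. p (x i)) = PiM I (\<lambda>_::nat. density lborel p)"
  proof (rule PiM_eqI[OF I])
    show "sets (density (PiM I (\<lambda>_. lborel)) (\<lambda>x. \<Prod>i\<in>I. p (x i)))
      = sets (PiM I (\<lambda>_::nat. density lborel p))"
      by (simp cong: sets_PiM_cong)
    fix A :: "nat \<Rightarrow> real set"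
    assume "\<And>i. i \<in> I \<Longrightarrow> A i \<in> sets (density lborel p)"
    then have A: "\<And>i. i \<in> I \<Longrightarrow> A i \<in> sets borel" by simp
    have "emeasure (density (PiM I (\<lambda>_. lborel)) (\<lambda>x. \<Prod>i\<in>I. p (x i))) (Pi\<^sub>E I A)
      = (\<integral>\<^sup>+x. (\<Prod>i\<in>I. p (x i)) * indicator (Pi\<^sub>E I A) x \<partial>PiM I (\<lambda>_. lborel))"
      using I A by (subst emeasure_density) (auto intro!: sets_PiM_I_finite)
    also have "\<dots> = (\<integral>\<^sup>+x. (\<Prod>i\<in>I. p (x i) * indicator (A i) (x i)) \<partial>PiM I (\<lambda>_. lborel))"
    proof (rule nn_integral_cong)
      fix x :: "nat \<Rightarrow> real" assume "x \<in> space (PiM I (\<lambda>_. lborel))"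
      then have "indicator (Pi\<^sub>E I A) x = (\<Prod>i\<in>I. indicator (A i) (x i) :: ennreal)"
        using I by (auto simp: space_PiM indicator_def PiE_iff)
      then show "(\<Prod>i\<in>I. p (x i)) * indicator (Pi\<^sub>E I A) x
        = (\<Prod>i\<in>I. p (x i) * indicator (A i) (x i))" by (simp add: prod.distrib)
    qed
    also have "\<dots> = (\<Prod>i\<in>I. \<integral>\<^sup>+y. p y * indicator (A i) y \<partial>lborel)"
      using I A by (intro lborel_PiM.product_nn_integral_prod) auto
    also have "\<dots> = (\<Prod>i\<in>I. emeasure (density lborel p) (A i))"
      using A by (intro prod.cong refl) (simp add: emeasure_density)
    finally show "emeasure (density (PiM I (\<lambda>_. lborel)) (\<lambda>x. \<Prod>i\<in>I. p (x i))) (Pi\<^sub>E I A)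
      = (\<Prod>i\<in>I. emeasure (density lborel p) (A i))" .
  qed
  then show ?thesis ..
qed

text \<open>The substitution \<open>x\<^sub>i = c\<^sub>i (d\<^sub>0, \<dots>, d\<^sub>i\<^sub>-\<^sub>1) + a\<^sub>i d\<^sub>i\<close> has Jacobian \<open>\<Prod>a\<^sub>i\<close>, whatever the functions
  \<open>c\<^sub>i\<close> are: integrating out the last coordinate first, each step is an affine substitution in one
  real variable. Both the passage from increments to values and the rescaling of all coordinates
  have this form.\<close>

lemma nn_integral_PiM_lborel_triangular:
  fixes a :: "nat \<Rightarrow> real" and c :: "nat \<Rightarrow> (nat \<Rightarrow> real) \<Rightarrow> real"
  assumes a: "\<And>i. 0 < a i"
    and c: "\<And>i. c i \<in> borel_measurable (PiM {..<i} (\<lambda>_. borel))"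
    and g: "g \<in> borel_measurable (PiM {..<m} (\<lambda>_. borel))"
  shows "(\<integral>\<^sup>+x. g x \<partial>PiM {..<m} (\<lambda>_. lborel)) =
    ennreal (\<Prod>i<m. a i) *
    (\<integral>\<^sup>+d. g (\<lambda>i\<in>{..<m}. c i (restrict d {..<i}) + a i * d i) \<partial>PiM {..<m} (\<lambda>_. lborel))"
  using g
proof (induction m arbitrary: g)
  case 0
  have "(\<lambda>i\<in>{..<0}. c i (restrict d {..<i}) + a i * d i) = (\<lambda>_. undefined)" for d by auto
  then show ?case by (simp add: PiM_empty nn_integral_count_space_finite)
next
  case (Suc m)
  let ?L = "\<lambda>m. PiM {..<m} (\<lambda>_. lborel) :: (nat \<Rightarrow> real) measure"
  let ?\<Phi> = "\<lambda>m d. \<lambda>i\<in>{..<m}. c i (restrict d {..<i}) + a i * d i"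
  have S: "{..<Suc m} = insert m {..<m}" for m by auto
  have sets: "\<And>i. sets (?L i) = sets (PiM {..<i} (\<lambda>_. borel))"
    by (rule sets_PiM_eq_borel) simp
  have c'[measurable]: "\<And>i. c i \<in> borel_measurable (?L i)"
    using c by (simp add: measurable_cong_sets[OF sets refl])
  have g'[measurable]: "g \<in> borel_measurable (PiM (insert m {..<m}) (\<lambda>_. lborel))"
    using Suc.prems by (simp add: measurable_cong_sets[OF sets refl] S[symmetric])
  have rm: "(\<lambda>d. c i (restrict d {..<i})) \<in> borel_measurable (?L j)" if "i \<le> j" for i j
  proof -
    have [measurable]: "(\<lambda>d. restrict d {..<i}) \<in> ?L j \<rightarrow>\<^sub>M ?L i"
      using that by (intro measurable_restrict_subset) auto
    show ?thesis by measurable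
  qed
  have \<Phi>[measurable]: "?\<Phi> j \<in> ?L j \<rightarrow>\<^sub>M ?L j" for j
    using rm[of _ j] by (intro measurable_restrict) (auto intro!: borel_measurable_add borel_measurable_times)
  have g\<Phi>: "(\<lambda>d. g (?\<Phi> (Suc m) d)) \<in> borel_measurable (?L (Suc m))"
    by (rule measurable_compose[OF \<Phi> g'[folded S]])
  have g\<Phi>': "(\<lambda>d. g (?\<Phi> (Suc m) d)) \<in> borel_measurable (PiM (insert m {..<m}) (\<lambda>_. lborel))"
    unfolding S[symmetric] by (rule g\<Phi>)
  have upd: "(\<lambda>x. \<integral>\<^sup>+y. G (x(m := y)) \<partial>lborel) \<in> borel_measurable (?L m)"
    if [measurable]: "G \<in> borel_measurable (PiM (insert m {..<m}) (\<lambda>_. lborel))"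
    for G :: "(nat \<Rightarrow> real) \<Rightarrow> ennreal" by measurable
  have Gm: "(\<lambda>x. \<integral>\<^sup>+y. g (x(m := y)) \<partial>lborel) \<in> borel_measurable (?L m)" by measurable
  have "(\<integral>\<^sup>+x. g x \<partial>?L (Suc m)) = (\<integral>\<^sup>+x. \<integral>\<^sup>+y. g (x(m := y)) \<partial>lborel \<partial>?L m)"
    unfolding S[of m] by (rule lborel_PiM.product_nn_integral_insert) auto
  also have "\<dots> = ennreal (\<Prod>i<m. a i) * (\<integral>\<^sup>+d. \<integral>\<^sup>+y. g ((?\<Phi> m d)(m := y)) \<partial>lborel \<partial>?L m)"
    using Gm unfolding measurable_cong_sets[OF sets refl] by (rule Suc.IH)
  also have "(\<integral>\<^sup>+d. \<integral>\<^sup>+y. g ((?\<Phi> m d)(m := y)) \<partial>lborel \<partial>?L m) =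
     (\<integral>\<^sup>+d. ennreal (a m) * (\<integral>\<^sup>+y. g (?\<Phi> (Suc m) (d(m := y))) \<partial>lborel) \<partial>?L m)"
  proof (rule nn_integral_cong)
    fix d assume d: "d \<in> space (?L m)"
    have eq: "?\<Phi> (Suc m) (d(m := y)) = (?\<Phi> m d)(m := c m (restrict d {..<m}) + a m * y)" for y
    proof
      fix l
      have "restrict (d(m := y)) {..<l} = restrict d {..<l}" if "l \<le> m"
        using that by (auto simp: restrict_def)
      then show "?\<Phi> (Suc m) (d(m := y)) l
        = ((?\<Phi> m d)(m := c m (restrict d {..<m}) + a m * y)) l" by auto
    qed
    have [measurable]: "?\<Phi> m d \<in> space (?L m)" by (auto simp: space_PiM)
    have "(\<lambda>y. g ((?\<Phi> m d)(m := y))) \<in> borel_measurable borel" by measurable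
    then show "(\<integral>\<^sup>+y. g ((?\<Phi> m d)(m := y)) \<partial>lborel)
      = ennreal (a m) * (\<integral>\<^sup>+y. g (?\<Phi> (Suc m) (d(m := y))) \<partial>lborel)"
      unfolding eq using a[of m]
      by (subst nn_integral_real_affine[where c="a m" and t="c m (restrict d {..<m})"]) auto
  qed
  also have "\<dots> = ennreal (a m) * (\<integral>\<^sup>+d. \<integral>\<^sup>+y. g (?\<Phi> (Suc m) (d(m := y))) \<partial>lborel \<partial>?L m)"
    by (rule nn_integral_cmult[OF upd[OF g\<Phi>']])
  also have "(\<integral>\<^sup>+d. \<integral>\<^sup>+y. g (?\<Phi> (Suc m) (d(m := y))) \<partial>lborel \<partial>?L m) = (\<integral>\<^sup>+d. g (?\<Phi> (Suc m) d) \<partial>?L (Suc m))"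
    unfolding S[of m] by (rule lborel_PiM.product_nn_integral_insert[symmetric, OF _ _ g\<Phi>[unfolded S]]) auto
  moreover have "ennreal (\<Prod>i<Suc m. a i) = ennreal (\<Prod>i<m. a i) * ennreal (a m)"
    using a[of m] by (simp add: ennreal_mult'' less_imp_le)
  ultimately show ?case by (simp only: mult.assoc)
qed

section \<open>The sorted sample\<close>

text \<open>Sorting as a map on functions supported on \<open>{..<m}\<close>, so that it acts on finite product spaces.\<close>

definition sort_vec :: "nat \<Rightarrow> (nat \<Rightarrow> real) \<Rightarrow> nat \<Rightarrow> real" where
  "sort_vec m x = (\<lambda>i\<in>{..<m}. sort (map x [0..<m]) ! i)"

lemma sort_vec_mono:
  assumes "mono_on {..<m} x"
  shows "sort_vec m x = restrict x {..<m}"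
proof -
  have "sorted (map x [0..<m])"
    using assms by (auto simp: sorted_iff_nth_mono mono_on_def)
  then show ?thesis by (auto simp: sort_vec_def sorted_sort_id)
qed

lemma sort_vec_permute:
  assumes "\<pi> permutes {..<m}"
  shows "sort_vec m (\<lambda>i\<in>{..<m}. x (\<pi> i)) = sort_vec m x"
proof -
  have "mset (map (\<lambda>i\<in>{..<m}. x (\<pi> i)) [0..<m]) = image_mset x (image_mset \<pi> (mset_set {..<m}))"
    by (simp add: multiset.map_comp comp_def lessThan_atLeast0)
       (rule image_mset_cong, simp)
  also have "image_mset \<pi> (mset_set {..<m}) = mset_set {..<m}"
    using assms by (simp add: image_mset_mset_set permutes_image permutes_inj_on)
  also have "image_mset x (mset_set {..<m}) = mset (map x [0..<m])"
    by (simp add: lessThan_atLeast0)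
  finally have "mset (map (\<lambda>i\<in>{..<m}. x (\<pi> i)) [0..<m]) = mset (map x [0..<m])" .
  then have "sort (map (\<lambda>i\<in>{..<m}. x (\<pi> i)) [0..<m]) = sort (map x [0..<m])"
    by (intro properties_for_sort) simp_all
  then show ?thesis by (simp add: sort_vec_def)
qed

text \<open>For pairwise distinct coordinates exactly one of the m! chambers of the permutation group contains
  x; this is what splits an integral over sorted vectors into m! equal parts.\<close>

lemma ex1_sorting_permutation:
  fixes x :: "nat \<Rightarrow> real"
  assumes inj: "inj_on x {..<m}"
  shows "\<exists>!\<pi>. \<pi> permutes {..<m} \<and> mono_on {..<m} (\<lambda>i\<in>{..<m}. x (\<pi> i))"
proof (rule ex_ex1I)
  obtain \<pi> where \<pi>: "\<pi> permutes {..<length (map x [0..<m])}"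
      "permute_list \<pi> (map x [0..<m]) = sort (map x [0..<m])"
    using mset_eq_permutation[of "sort (map x [0..<m])" "map x [0..<m]"] by auto
  then have p: "\<pi> permutes {..<m}" by simp
  have nth: "sort (map x [0..<m]) ! i = x (\<pi> i)" if "i < m" for i
    using that p permutes_in_image[OF p, of i] unfolding \<pi>(2)[symmetric]
    by (simp add: permute_list_def)
  have "mono_on {..<m} (\<lambda>i\<in>{..<m}. x (\<pi> i))"
  proof (rule mono_onI)
    fix r s assume "r \<in> {..<m}" "s \<in> {..<m}" "r \<le> s"
    then show "(\<lambda>i\<in>{..<m}. x (\<pi> i)) r \<le> (\<lambda>i\<in>{..<m}. x (\<pi> i)) s"
      using sorted_nth_mono[OF sorted_sort, of r s "map x [0..<m]"] by (simp add: nth)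
  qed
  with p show "\<exists>\<pi>. \<pi> permutes {..<m} \<and> mono_on {..<m} (\<lambda>i\<in>{..<m}. x (\<pi> i))" by blast
next
  fix \<pi> \<sigma>
  assume \<pi>: "\<pi> permutes {..<m} \<and> mono_on {..<m} (\<lambda>i\<in>{..<m}. x (\<pi> i))"
    and \<sigma>: "\<sigma> permutes {..<m} \<and> mono_on {..<m} (\<lambda>i\<in>{..<m}. x (\<sigma> i))"
  have eq: "(\<lambda>i\<in>{..<m}. x (\<pi> i)) = (\<lambda>i\<in>{..<m}. x (\<sigma> i))"
    using \<pi> \<sigma> sort_vec_mono[of m "\<lambda>i\<in>{..<m}. x (\<pi> i)"] sort_vec_mono[of m "\<lambda>i\<in>{..<m}. x (\<sigma> i)"]
    by (simp add: sort_vec_permute)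
  show "\<pi> = \<sigma>"
  proof
    fix i show "\<pi> i = \<sigma> i"
    proof (cases "i < m")
      case True
      then have "x (\<pi> i) = x (\<sigma> i)" using fun_cong[OF eq, of i] by simp
      moreover have "\<pi> i < m" "\<sigma> i < m"
        using True \<pi> \<sigma> permutes_in_image[of _ "{..<m}" i] by auto
      ultimately show ?thesis using inj by (auto dest: inj_onD)
    next
      case False
      then show ?thesis using \<pi> \<sigma> by (metis lessThan_iff permutes_not_in)
    qed
  qed
qed

text \<open>Order statistics are measurable because their sublevel sets are described by counting the
  observations below a threshold.\<close>

lemma sorted_nth_le_iff_length_filter:
  fixes t :: "'a :: linorder"
  assumes "sorted ys" "i < length ys"
  shows "ys ! i \<le> t \<longleftrightarrow> i < length (filter (\<lambda>y. y \<le> t) ys)"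
  using assms
proof (induction ys arbitrary: i)
  case (Cons y ys)
  show ?case
  proof (cases "y \<le> t")
    case True
    with Cons show ?thesis by (cases i) auto
  next
    case False
    have "y \<le> (y # ys) ! i" using Cons.prems by (cases i) auto
    moreover have "filter (\<lambda>y. y \<le> t) (y # ys) = []" using False Cons.prems by (auto simp: filter_empty_conv)
    ultimately show ?thesis using False by auto
  qed
qed simp

lemma measurable_mono_on [measurable]:
  "Measurable.pred (PiM {..<m::nat} (\<lambda>_. borel)) (\<lambda>x::nat \<Rightarrow> real. mono_on {..<m} x)"
proof -
  have *: "Measurable.pred (PiM {..<m} (\<lambda>_. borel)) (\<lambda>x::nat \<Rightarrow> real. \<forall>i\<in>{..<m}. \<forall>j\<in>{..<m}. i \<le> j \<longrightarrow> x i \<le> x j)"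
  proof (intro pred_intros_finite pred_intros_imp' finite_lessThan)
    fix i j assume "i \<in> {..<m}" "j \<in> {..<m}"
    then show "Measurable.pred (PiM {..<m} (\<lambda>_. borel)) (\<lambda>x::nat \<Rightarrow> real. x i \<le> x j)"
      unfolding pred_def by (intro borel_measurable_le measurable_component_singleton)
  qed
  have eq: "(\<lambda>x::nat \<Rightarrow> real. mono_on {..<m} x) = (\<lambda>x. \<forall>i\<in>{..<m}. \<forall>j\<in>{..<m}. i \<le> j \<longrightarrow> x i \<le> x j)"
    by (intro ext) (auto simp: mono_on_def)
  show ?thesis by (subst eq) (rule *)
qed

lemma measurable_sort_vec [measurable]:
  "sort_vec m \<in> PiM {..<m} (\<lambda>_. borel) \<rightarrow>\<^sub>M PiM {..<m} (\<lambda>_. borel)"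
  unfolding sort_vec_def[abs_def]
proof (rule measurable_restrict)
  fix i assume i: "i \<in> {..<m}"
  show "(\<lambda>x :: nat \<Rightarrow> real. sort (map x [0..<m]) ! i) \<in> borel_measurable (PiM {..<m} (\<lambda>_. borel))"
  proof (rule borel_measurableI_le)
    fix t :: real
    have "sort (map x [0..<m]) ! i \<le> t \<longleftrightarrow> real i < (\<Sum>l<m. indicator {..t} (x l))" for x :: "nat \<Rightarrow> real"
    proof -
      have "length (filter (\<lambda>y. y \<le> t) (sort (map x [0..<m])))
        = length (filter (\<lambda>y. y \<le> t) (map x [0..<m]))"
        by (metis mset_filter mset_sort size_mset)
      also have "\<dots> = card {l \<in> {..<m}. x l \<le> t}"
        by (simp add: length_filter_conv_card) (rule arg_cong[of _ _ card], auto)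
      also have "real (card {l \<in> {..<m}. x l \<le> t}) = (\<Sum>l<m. indicator {..t} (x l))"
        by (simp add: indicator_def sum.If_cases Int_def)
      finally show ?thesis
        using i by (subst sorted_nth_le_iff_length_filter) (auto simp flip: of_nat_less_iff)
    qed
    then show "{x \<in> space (PiM {..<m} (\<lambda>_. borel)). sort (map x [0..<m]) ! i \<le> t}
      \<in> sets (PiM {..<m} (\<lambda>_. borel))" by simp
  qed
qed

lemma AE_PiM_components_neq:
  fixes \<mu> :: "real measure" and i j m :: nat
  assumes prob: "prob_space \<mu>" and sets: "sets \<mu> = sets borel"
    and atomless: "\<And>y. emeasure \<mu> {y} = 0" and ij: "i < m" "j < m" "i \<noteq> j"
  shows "AE x in PiM {..<m} (\<lambda>_. \<mu>). x i \<noteq> x j"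
proof -
  interpret P: prob_space \<mu> by fact
  interpret product_sigma_finite "\<lambda>_::nat. \<mu>" by standard
  note sets[measurable_cong]
  define I where "I = {..<m} - {i}"
  have I: "{..<m} = insert i I" "finite I" "i \<notin> I" "j \<in> I" using ij by (auto simp: I_def)
  let ?A = "{x \<in> space (PiM {..<m} (\<lambda>_. \<mu>)). x i = x j}"
  have [measurable]: "?A \<in> sets (PiM {..<m} (\<lambda>_. \<mu>))"
    using ij by (intro borel_measurable_eq) (auto simp: measurable_cong_sets[OF refl sets[symmetric]])
  have "emeasure (PiM {..<m} (\<lambda>_. \<mu>)) ?A = (\<integral>\<^sup>+x. indicator ?A x \<partial>PiM (insert i I) (\<lambda>_. \<mu>))"
    by (simp flip: I(1))
  also have "\<dots> = (\<integral>\<^sup>+x. \<integral>\<^sup>+y. indicator ?A (x(i := y)) \<partial>\<mu> \<partial>PiM I (\<lambda>_. \<mu>))"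
    using I by (intro product_nn_integral_insert) (auto simp flip: I(1))
  also have "\<dots> = (\<integral>\<^sup>+x. \<integral>\<^sup>+y. indicator {x j} y \<partial>\<mu> \<partial>PiM I (\<lambda>_. \<mu>))"
    using I(4) ij unfolding I(1)
    by (intro nn_integral_cong) (auto simp: indicator_def space_PiM PiE_iff extensional_def sets_eq_imp_space_eq[OF sets])
  also have "\<dots> = 0" using atomless by (simp add: sets)
  finally show ?thesis
    by (intro AE_I[where N = ?A]) auto
qed

text \<open>Almost surely there are no ties, so the space is the disjoint union of the m! chambers obtained by
  permuting the coordinates of the ordered one. Each contributes the same amount, since the product
  measure is invariant under permutations.\<close>

lemma nn_integral_sort_vec:
  fixes \<mu> :: "real measure"
  assumes prob: "prob_space \<mu>" and sets: "sets \<mu> = sets borel"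
    and atomless: "\<And>y. emeasure \<mu> {y} = 0"
    and h: "h \<in> borel_measurable (PiM {..<m} (\<lambda>_. borel))"
  shows "(\<integral>\<^sup>+x. h (sort_vec m x) \<partial>PiM {..<m} (\<lambda>_. \<mu>)) =
    fact m * (\<integral>\<^sup>+x. indicator {x. mono_on {..<m} x} x * h x \<partial>PiM {..<m} (\<lambda>_. \<mu>))"
proof -
  interpret P: prob_space \<mu> by fact
  note sets[measurable_cong] h[measurable]
  let ?P = "PiM {..<m} (\<lambda>_. \<mu>)"
  let ?S = "{\<pi>. \<pi> permutes {..<m}}"
  let ?perm = "\<lambda>\<pi> x. \<lambda>i\<in>{..<m}. x (\<pi> i) :: real"
  let ?H = "\<lambda>x. indicator {x. mono_on {..<m} x} x * h x"
  have sP: "sets ?P = sets (PiM {..<m} (\<lambda>_. borel))" by (rule sets_PiM_eq_borel) fact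
  have H[measurable]: "?H \<in> borel_measurable ?P"
    by measurable
  have fin: "finite ?S" by (simp add: finite_permutations)
  have perm[measurable]: "?perm \<pi> \<in> ?P \<rightarrow>\<^sub>M ?P" if "\<pi> permutes {..<m}" for \<pi>
    using permutes_in_image[OF that] by (intro measurable_restrict measurable_component_singleton) auto
  have "AE x in ?P. \<forall>i\<in>{..<m}. \<forall>j\<in>{..<m}. i \<noteq> j \<longrightarrow> x i \<noteq> x j"
    using AE_PiM_components_neq[OF prob sets atomless, of _ m]
    by (intro AE_finite_allI) (auto intro!: AE_impI)
  then have "AE x in ?P. h (sort_vec m x) = (\<Sum>\<pi>\<in>?S. ?H (?perm \<pi> x))"
  proof eventually_elim
    case (elim x)
    then have "inj_on x {..<m}" by (auto simp: inj_on_def)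
    from ex1_sorting_permutation[OF this] obtain \<pi> where
      \<pi>: "\<pi> permutes {..<m}" "mono_on {..<m} (?perm \<pi> x)"
      and uniq: "\<And>\<sigma>. \<sigma> permutes {..<m} \<Longrightarrow> mono_on {..<m} (?perm \<sigma> x) \<Longrightarrow> \<sigma> = \<pi>"
      by blast
    have "(\<Sum>\<sigma>\<in>?S. ?H (?perm \<sigma> x)) = (\<Sum>\<sigma>\<in>{\<pi>}. ?H (?perm \<sigma> x))"
      proof (rule sum.mono_neutral_right[OF fin])
      show "{\<pi>} \<subseteq> ?S" using \<pi> by simp
      show "\<forall>\<sigma>\<in>?S - {\<pi>}. ?H (?perm \<sigma> x) = 0"
        using uniq by (auto simp: indicator_def)
    qed
    also have "\<dots> = h (?perm \<pi> x)" using \<pi> by simp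
    also have "?perm \<pi> x = sort_vec m x"
      using sort_vec_mono[OF \<pi>(2)] sort_vec_permute[OF \<pi>(1), of x] by simp
    finally show ?case by (rule sym)
  qed
  then have "(\<integral>\<^sup>+x. h (sort_vec m x) \<partial>?P) = (\<integral>\<^sup>+x. (\<Sum>\<pi>\<in>?S. ?H (?perm \<pi> x)) \<partial>?P)"
    by (rule nn_integral_cong_AE)
  also have "\<dots> = (\<Sum>\<pi>\<in>?S. \<integral>\<^sup>+x. ?H (?perm \<pi> x) \<partial>?P)"
    by (rule nn_integral_sum) (use measurable_compose[OF perm H] in auto)
  also have "\<dots> = (\<Sum>\<pi>\<in>?S. \<integral>\<^sup>+x. ?H x \<partial>?P)"
  proof (rule sum.cong[OF refl])
    fix \<pi> assume "\<pi> \<in> ?S"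
    then have \<pi>: "\<pi> permutes {..<m}" by simp
    have D: "distr ?P ?P (?perm \<pi>) = ?P"
      using prob permutes_inj_on[OF \<pi>] permutes_in_image[OF \<pi>]
      by (subst distr_PiM_reindex) (auto simp: inj_on_def)
    have "(\<integral>\<^sup>+x. ?H x \<partial>distr ?P ?P (?perm \<pi>)) = (\<integral>\<^sup>+x. ?H (?perm \<pi> x) \<partial>?P)"
      using H by (intro nn_integral_distr perm \<pi>) simp
    then show "(\<integral>\<^sup>+x. ?H (?perm \<pi> x) \<partial>?P) = (\<integral>\<^sup>+x. ?H x \<partial>?P)"
      unfolding D by (rule sym)
  qed
  also have "\<dots> = fact m * (\<integral>\<^sup>+x. ?H x \<partial>?P)"
    by (simp add: card_permutations)
  finally show ?thesis .
qed

section \<open>Spacings of a sorted exponential sample\<close>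

lemma fact_eq_ennreal: "(fact n :: ennreal) = ennreal (fact n)"
  by (metis ennreal_of_nat_eq_real_of_nat of_nat_fact)

abbreviation exp_law :: "real measure" where
  "exp_law \<equiv> density lborel (\<lambda>x. ennreal (exponential_density 1 x))"

abbreviation unif_law :: "real measure" where
  "unif_law \<equiv> uniform_measure lborel {0..1}"

lemma prob_space_exp_law: "prob_space exp_law"
  using prob_space_exponential_density[of 1] by simp

lemma emeasure_density_lborel_singleton:
  "p \<in> borel_measurable borel \<Longrightarrow> emeasure (density lborel p) {y::real} = 0"
  using AE_lborel_singleton[of y]
  by (subst emeasure_density) (auto simp: nn_integral_0_iff_AE elim!: eventually_mono)

text \<open>Normalized spacings of m values, the first one being measured from the origin. The weight
  \<open>m - i\<close> is the number of observations that are still to come after i of them have been seen.\<close>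

definition spacing_vec :: "nat \<Rightarrow> (nat \<Rightarrow> real) \<Rightarrow> nat \<Rightarrow> real" where
  "spacing_vec m x = (\<lambda>i\<in>{..<m}. (real m - real i) * (x i - (if i = 0 then 0 else x (i - 1))))"

lemma measurable_spacing_vec [measurable]:
  "spacing_vec m \<in> PiM {..<m} (\<lambda>_. borel) \<rightarrow>\<^sub>M PiM {..<m} (\<lambda>_. borel)"
  unfolding spacing_vec_def[abs_def]
proof (rule measurable_restrict)
  fix i assume i: "i \<in> {..<m}"
  show "(\<lambda>x. (real m - real i) * (x i - (if i = 0 then 0 else x (i - 1))))
    \<in> borel_measurable (PiM {..<m} (\<lambda>_. borel))"
    using i by (cases "i = 0") auto
qed

text \<open>Summation by parts. For \<open>j = m\<close> the boundary term vanishes, so the normalized spacings have the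
  same sum as the values; this is why the exponential density keeps its form.\<close>

lemma sum_spacing:
  fixes x :: "nat \<Rightarrow> real"
  shows "(\<Sum>i<j. (real m - real i) * (x i - (if i = 0 then 0 else x (i - 1))))
    = (\<Sum>i<j. x i) + (real m - real j) * (if j = 0 then 0 else x (j - 1))"
  by (induction j) (auto simp: algebra_simps)

lemma mono_on_nonneg_iff_increments:
  fixes x :: "nat \<Rightarrow> real"
  shows "mono_on {..<m} x \<and> (\<forall>i<m. 0 \<le> x i)
    \<longleftrightarrow> (\<forall>i<m. 0 \<le> x i - (if i = 0 then 0 else x (i - 1)))" (is "?L \<longleftrightarrow> ?R")
proof
  assume ?L then show ?R by (auto simp: mono_on_def)
next
  assume R: ?R
  have mono: "x i \<le> x j" if "i \<le> j" "j < m" for i j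
    using that
  proof (induction j rule: dec_induct)
    case (step l)
    then show ?case using R[rule_format, of "Suc l"] by simp
  qed simp
  have "0 \<le> x i" if "i < m" for i
    using mono[of 0 i] R[rule_format, of 0] that by simp
  with mono show ?L by (auto intro!: mono_onI)
qed

lemma prod_exponential_density:
  fixes x :: "nat \<Rightarrow> real"
  shows "(\<Prod>i<m. ennreal (exponential_density 1 (x i)))
    = indicator {x. \<forall>i<m. 0 \<le> x i} x * ennreal (exp (- (\<Sum>i<m. x i)))"
proof (cases "\<forall>i<m. 0 \<le> x i")
  case True
  then have "(\<Prod>i<m. ennreal (exponential_density 1 (x i))) = (\<Prod>i<m. ennreal (exp (- x i)))"
    by (intro prod.cong) (auto simp: exponential_density_def not_less[symmetric])
  also have "\<dots> = ennreal (\<Prod>i<m. exp (- x i))" by (simp add: prod_ennreal)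
  also have "(\<Prod>i<m. exp (- x i)) = exp (- (\<Sum>i<m. x i))"
    by (subst exp_sum[symmetric]) (simp_all add: sum_negf)
  finally show ?thesis using True by simp
next
  case False
  then obtain i where "i < m" "x i < 0" by (auto simp: not_le)
  then have "(\<Prod>i<m. ennreal (exponential_density 1 (x i))) = 0"
    by (intro prod_zero) (auto simp: exponential_density_def)
  with False show ?thesis by simp
qed

text \<open>The product density restricted to the ordered chamber is the product density of the spacings:
  nonnegative spacings describe the nonnegative ordered vectors, and the sums in the exponents
  agree.\<close>

lemma exponential_density_spacing:
  "(\<Prod>i<m. ennreal (exponential_density 1 (spacing_vec m x i)))
   = (\<Prod>i<m. ennreal (exponential_density 1 (x i))) * indicator {x. mono_on {..<m} x} x"
proof -
  have "(\<Sum>i<m. spacing_vec m x i) = (\<Sum>i<m. x i)"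
    using sum_spacing[of m x m] by (simp add: spacing_vec_def)
  moreover have "(\<forall>i<m. 0 \<le> spacing_vec m x i) \<longleftrightarrow> mono_on {..<m} x \<and> (\<forall>i<m. 0 \<le> x i)"
    unfolding mono_on_nonneg_iff_increments
    by (auto simp: spacing_vec_def zero_le_mult_iff)
  ultimately show ?thesis
    unfolding prod_exponential_density by (auto simp: indicator_def)
qed

lemma prod_of_reciprocals_fact:
  "ennreal (\<Prod>i<m. 1 / (real m - real i)) * fact m = 1"
proof -
  have "(\<Prod>i<m. real m - real i) = fact m"
    by (simp add: fact_prod_rev lessThan_atLeast0 of_nat_diff)
  then have "(\<Prod>i<m. 1 / (real m - real i)) = 1 / fact m"
    by (simp add: prod_dividef)
  moreover have "ennreal (1 / fact m) * ennreal (fact m) = 1"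
    by (subst ennreal_mult'[symmetric]) simp_all
  ultimately show ?thesis by (simp add: fact_eq_ennreal)
qed

text \<open>Sorting multiplies the density by m! on the chamber, and the substitution that
  expresses the sorted values by their spacings has Jacobian 1/m!; the density itself is preserved.\<close>

lemma distr_spacing_sort_vec_exp:
  "distr (PiM {..<m} (\<lambda>_. exp_law)) (PiM {..<m} (\<lambda>_. borel)) (\<lambda>x. spacing_vec m (sort_vec m x))
   = PiM {..<m} (\<lambda>_. exp_law)" (is "distr ?E ?B ?s = _")
proof (rule measure_eqI)
  have sE: "sets ?E = sets ?B" by (rule sets_PiM_eq_borel) simp
  have sL: "sets (PiM {..<m} (\<lambda>_. lborel)) = sets ?B" by (rule sets_PiM_eq_borel) simp
  note sE[measurable_cong] sL[measurable_cong]
  show "sets (distr ?E ?B ?s) = sets ?E" by (simp add: sE)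
  fix A assume "A \<in> sets (distr ?E ?B ?s)"
  then have A[measurable]: "A \<in> sets ?B" by simp
  let ?e = "\<lambda>x. \<Prod>i<m. ennreal (exponential_density 1 (x i))"
  let ?mono = "indicator {x. mono_on {..<m} x} :: (nat \<Rightarrow> real) \<Rightarrow> ennreal"
  \<comment> \<open>Beyond m the value only has to be positive.\<close>
  define a where "a i = (if i < m then 1 / (real m - real i) else 1)" for i
  have a: "0 < a i" for i by (simp add: a_def)
  have prod_a: "(\<Prod>i<m. a i) = (\<Prod>i<m. 1 / (real m - real i))"
    by (intro prod.cong) (auto simp: a_def)
  define c where "c i d = (\<Sum>k<i. a k * d k)" for i and d :: "nat \<Rightarrow> real"
  have c: "c i \<in> borel_measurable (PiM {..<i} (\<lambda>_. borel))" for i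
    unfolding c_def[abs_def] by measurable
  let ?\<Phi> = "\<lambda>d. \<lambda>i\<in>{..<m}. c i (restrict d {..<i}) + a i * d i"
  have E: "?E = density (PiM {..<m} (\<lambda>_. lborel)) ?e"
    by (rule PiM_density_lborel) (auto intro: prob_space_exp_law)
  have [measurable]: "?e \<in> borel_measurable ?B" by measurable
  have \<Phi>: "spacing_vec m (?\<Phi> d) = d" if "d \<in> space (PiM {..<m} (\<lambda>_. lborel))" for d
  proof
    fix i
    define x where "x = ?\<Phi> d"
    have x: "x j = (\<Sum>k\<le>j. a k * d k)" if "j < m" for j
      using that by (simp add: x_def c_def lessThan_Suc_atMost[symmetric])
    have "spacing_vec m x i = d i"
    proof (cases "i < m")
      case True
      have "x i - (if i = 0 then 0 else x (i - 1)) = a i * d i"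
        using True by (cases i) (simp_all add: x)
      then show ?thesis using True by (simp add: spacing_vec_def a_def)
    next
      case False
      then show ?thesis using that by (simp add: spacing_vec_def space_PiM PiE_iff extensional_def)
    qed
    then show "spacing_vec m (?\<Phi> d) i = d i" unfolding x_def .
  qed
  have "emeasure (distr ?E ?B ?s) A = (\<integral>\<^sup>+x. indicator A (?s x) \<partial>?E)"
    by (subst nn_integral_indicator[symmetric], simp, subst nn_integral_distr) simp_all
  also have "\<dots> = fact m * (\<integral>\<^sup>+x. ?mono x * indicator A (spacing_vec m x) \<partial>?E)"
    by (rule nn_integral_sort_vec[OF prob_space_exp_law])
       (auto intro!: emeasure_density_lborel_singleton)
  also have "(\<integral>\<^sup>+x. ?mono x * indicator A (spacing_vec m x) \<partial>?E)
    = (\<integral>\<^sup>+x. ?e x * (?mono x * indicator A (spacing_vec m x)) \<partial>PiM {..<m} (\<lambda>_. lborel))"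
    unfolding E by (rule nn_integral_density) measurable
  also have "\<dots> = (\<integral>\<^sup>+x. ?e (spacing_vec m x) * indicator A (spacing_vec m x) \<partial>PiM {..<m} (\<lambda>_. lborel))"
    by (simp add: exponential_density_spacing mult.assoc)
  also have "\<dots> = ennreal (\<Prod>i<m. a i) *
      (\<integral>\<^sup>+d. ?e (spacing_vec m (?\<Phi> d)) * indicator A (spacing_vec m (?\<Phi> d)) \<partial>PiM {..<m} (\<lambda>_. lborel))"
    by (rule nn_integral_PiM_lborel_triangular[OF a c]) measurable
  also have "(\<integral>\<^sup>+d. ?e (spacing_vec m (?\<Phi> d)) * indicator A (spacing_vec m (?\<Phi> d)) \<partial>PiM {..<m} (\<lambda>_. lborel))
    = (\<integral>\<^sup>+d. ?e d * indicator A d \<partial>PiM {..<m} (\<lambda>_. lborel))"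
    by (rule nn_integral_cong) (simp only: \<Phi>)
  also have "\<dots> = emeasure ?E A"
    unfolding E by (rule emeasure_density[symmetric]) measurable
  also have "fact m * (ennreal (\<Prod>i<m. a i) * emeasure ?E A) = emeasure ?E A"
    by (simp only: prod_a mult.assoc[symmetric] mult.commute[of "fact m"]
          prod_of_reciprocals_fact mult_1_left)
  finally show "emeasure (distr ?E ?B ?s) A = emeasure ?E A" .
qed

section \<open>Ratios of partial sums of exponential variables\<close>

text \<open>The partial sums map the nonnegative orthant onto the nonnegative part of the ordered chamber.\<close>

lemma nonneg_mono_iff_increments_nonneg:
  fixes d :: "nat \<Rightarrow> real"
  shows "(\<forall>i<m. 0 \<le> d i) \<longleftrightarrow>
    mono_on {..<m} (\<lambda>i. \<Sum>k\<le>i. d k) \<and> (\<forall>i<m. 0 \<le> (\<Sum>k\<le>i. d k))"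
proof -
  have "(\<Sum>k\<le>i. d k) - (if i = 0 then 0 else (\<Sum>k\<le>i - 1. d k)) = d i" for i
    by (cases i) auto
  then show ?thesis by (simp only: mono_on_nonneg_iff_increments)
qed

lemma indicator_unif_prod:
  fixes x :: "nat \<Rightarrow> real"
  shows "(\<Prod>i<n. indicator {0..1} (x i) :: ennreal) = indicator {x. \<forall>i<n. x i \<in> {0..1::real}} x"
proof (cases "\<forall>i<n. x i \<in> {0..1}")
  case True then show ?thesis by (simp add: indicator_def)
next
  case False
  then obtain i where "i < n" "x i \<notin> {0..1}" by auto
  then have "(\<Prod>i<n. indicator {0..1} (x i) :: ennreal) = 0"
    by (intro prod_zero) (auto intro!: bexI[of _ i])
  with False show ?thesis by (simp add: indicator_def)
qed

lemma nn_integral_power_times_exp_Ioi: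
  "(\<integral>\<^sup>+y. indicator {0<..} y * ennreal (y ^ n * exp (- y)) \<partial>lborel) = fact n"
proof -
  have "(\<integral>\<^sup>+y. indicator {0<..} y * ennreal (y ^ n * exp (- y)) \<partial>lborel)
    = (\<integral>\<^sup>+y. ennreal (y ^ n * exp (- y)) * indicator {0..} y \<partial>lborel)"
    using AE_lborel_singleton[of "0::real"]
    by (intro nn_integral_cong_AE) (auto elim!: eventually_mono simp: indicator_def)
  then show ?thesis
    using nn_intergal_power_times_exp_Ici[of n] by (simp add: fact_eq_ennreal)
qed

lemma unif_law_eq_density: "unif_law = density lborel (indicator {0..1})"
  by (simp add: uniform_measure_def divide_ennreal_def)

lemma prob_space_unif_law: "prob_space unif_law"
  by (intro prob_space_uniform_measure) auto

lemma pred_ball_less: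
  assumes "\<And>i::nat. i < m \<Longrightarrow> Measurable.pred M (P i)"
  shows "Measurable.pred M (\<lambda>x. \<forall>i<m. P i x)"
proof -
  have *: "Measurable.pred M (\<lambda>x. \<forall>i\<in>{..<m}. P i x)"
    using assms by (intro pred_intros_finite) auto
  have eq: "(\<lambda>x. \<forall>i<m. P i x) = (\<lambda>x. \<forall>i\<in>{..<m}. P i x)" by auto
  show ?thesis by (subst eq) (rule *)
qed

text \<open>In terms of the partial sums \<open>x\<^sub>0 \<le> \<dots> \<le> x\<^sub>n\<close> the density is \<open>exp (- x\<^sub>n)\<close>, so given \<open>x\<^sub>n = y\<close> the
  others are uniformly distributed on an ordered box of side y. Scaling this box to side 1 yields
  the factor \<open>y\<^sup>n\<close>, and \<open>\<integral> y\<^sup>n exp (- y) dy = n!\<close> is the normalization of the ordered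
  uniform density.\<close>

lemma distr_partial_sum_ratios_exp:
  "distr (PiM {..<Suc n} (\<lambda>_. exp_law)) (PiM {..<n} (\<lambda>_. borel))
     (\<lambda>d. \<lambda>i\<in>{..<n}. (\<Sum>k\<le>i. d k) / (\<Sum>k\<le>n. d k))
   = distr (PiM {..<n} (\<lambda>_. unif_law)) (PiM {..<n} (\<lambda>_. borel)) (sort_vec n)"
  (is "distr ?E ?B ?r = distr ?U ?B _")
proof (rule measure_eqI)
  show "sets (distr ?E ?B ?r) = sets (distr ?U ?B (sort_vec n))" by simp
  fix A assume "A \<in> sets (distr ?E ?B ?r)"
  then have A[measurable]: "A \<in> sets ?B" by simp
  let ?L = "\<lambda>m. PiM {..<m} (\<lambda>_. lborel) :: (nat \<Rightarrow> real) measure"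
  let ?e = "\<lambda>x. \<Prod>i<Suc n. ennreal (exponential_density 1 (x i))"
  have sE: "sets ?E = sets (PiM {..<Suc n} (\<lambda>_. borel))" by (rule sets_PiM_eq_borel) simp
  have sU: "sets ?U = sets ?B" by (rule sets_PiM_eq_borel) simp
  have sL: "sets (?L m) = sets (PiM {..<m} (\<lambda>_. borel))" for m by (rule sets_PiM_eq_borel) simp
  note sE[measurable_cong] sU[measurable_cong] sL[measurable_cong]
  \<comment> \<open>The ordered box of side y, and K the integral of the test function over the ordered unit box.\<close>
  define box where "box y = {x :: nat \<Rightarrow> real. mono_on {..<n} x \<and> (\<forall>i<n. 0 \<le> x i \<and> x i \<le> y)}" for y
  have box[measurable]: "Measurable.pred ?B (\<lambda>x. x \<in> box y)" for y
    unfolding box_def mem_Collect_eq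
    by (intro pred_intros_logic pred_ball_less)
       (rule measurable_mono_on, (unfold pred_def, intro borel_measurable_le measurable_component_singleton; simp)+)
  define K where "K = (\<integral>\<^sup>+x. indicator (box 1) x * indicator A x \<partial>?L n)"

  have U: "?U = density (?L n) (\<lambda>x. \<Prod>i<n. indicator {0..1} (x i))"
    unfolding unif_law_eq_density
    by (rule PiM_density_lborel) (use prob_space_unif_law in \<open>auto simp: unif_law_eq_density\<close>)
  have "emeasure (distr ?U ?B (sort_vec n)) A = (\<integral>\<^sup>+x. indicator A (sort_vec n x) \<partial>?U)"
    by (subst nn_integral_indicator[symmetric], simp, subst nn_integral_distr) simp_all
  also have "\<dots> = fact n * (\<integral>\<^sup>+x. indicator {x. mono_on {..<n} x} x * indicator A x \<partial>?U)"
    by (rule nn_integral_sort_vec[OF prob_space_unif_law])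
       (auto simp: unif_law_eq_density intro!: emeasure_density_lborel_singleton)
  also have "(\<integral>\<^sup>+x. indicator {x. mono_on {..<n} x} x * indicator A x \<partial>?U)
    = (\<integral>\<^sup>+x. (\<Prod>i<n. indicator {0..1} (x i)) * (indicator {x. mono_on {..<n} x} x * indicator A x) \<partial>?L n)"
    unfolding U by (rule nn_integral_density) measurable
  also have "\<dots> = K"
    unfolding K_def indicator_unif_prod
    by (intro nn_integral_cong) (auto simp: indicator_def box_def)
  finally have uniform: "emeasure (distr ?U ?B (sort_vec n)) A = fact n * K" .

  \<comment> \<open>The integrand expressed in the partial sums x of d.\<close>
  define G :: "(nat \<Rightarrow> real) \<Rightarrow> ennreal" where
    "G x = indicator {x. mono_on {..<Suc n} x \<and> (\<forall>i<Suc n. 0 \<le> x i)} x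
      * ennreal (exp (- x n)) * indicator A (\<lambda>i\<in>{..<n}. x i / x n)" for x
  have quot[measurable]: "(\<lambda>x. \<lambda>i\<in>{..<n}. x i / x n) \<in> PiM {..<Suc n} (\<lambda>_. borel) \<rightarrow>\<^sub>M ?B"
    by (intro measurable_restrict borel_measurable_divide measurable_component_singleton) auto
  have [measurable]: "Measurable.pred (PiM {..<Suc n} (\<lambda>_. borel))
      (\<lambda>x :: nat \<Rightarrow> real. mono_on {..<Suc n} x \<and> (\<forall>i<Suc n. 0 \<le> x i))"
    by (intro pred_intros_logic pred_ball_less)
       (rule measurable_mono_on, (unfold pred_def, intro borel_measurable_le measurable_component_singleton; simp)+)
  have G[measurable]: "G \<in> borel_measurable (PiM {..<Suc n} (\<lambda>_. borel))"
    unfolding G_def[abs_def] by measurable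
  define c where "c i d = (\<Sum>k<i. d k)" for i and d :: "nat \<Rightarrow> real"
  have c: "c i \<in> borel_measurable (PiM {..<i} (\<lambda>_. borel))" for i
    unfolding c_def[abs_def] by measurable
  have r[measurable]: "?r \<in> PiM {..<Suc n} (\<lambda>_. borel) \<rightarrow>\<^sub>M ?B"
    by (intro measurable_restrict borel_measurable_divide borel_measurable_sum
          measurable_component_singleton) auto
  have e[measurable]: "?e \<in> borel_measurable (PiM {..<Suc n} (\<lambda>_. borel))" by measurable
  have E: "?E = density (?L (Suc n)) ?e"
    by (rule PiM_density_lborel) (auto intro: prob_space_exp_law)
  have G_sums: "?e d * indicator A (?r d) = G (\<lambda>i\<in>{..<Suc n}. c i (restrict d {..<i}) + 1 * d i)" for d
  proof -
    define x where "x = (\<lambda>i\<in>{..<Suc n}. c i (restrict d {..<i}) + 1 * d i)"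
    have x: "x j = (\<Sum>k\<le>j. d k)" if "j < Suc n" for j
      using that by (simp add: x_def c_def lessThan_Suc_atMost[symmetric])
    have "(\<forall>i<Suc n. 0 \<le> d i) \<longleftrightarrow> mono_on {..<Suc n} x \<and> (\<forall>i<Suc n. 0 \<le> x i)"
      using nonneg_mono_iff_increments_nonneg[of "Suc n" d] by (simp add: x mono_on_def)
    moreover have "(\<Sum>i<Suc n. d i) = x n" by (simp add: x lessThan_Suc_atMost)
    moreover have "(\<lambda>i\<in>{..<n}. x i / x n) = ?r d" by (auto simp: x)
    ultimately show ?thesis
      unfolding x_def[symmetric] G_def prod_exponential_density by (simp add: indicator_def)
  qed
  \<comment> \<open>Integral over the first n partial sums while the last one equals y.\<close>
  have scale: "(\<integral>\<^sup>+x. G (x(n := y)) \<partial>?L n) = indicator {0<..} y * ennreal (y ^ n * exp (- y)) * K"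
    if "y \<noteq> 0" for y
  proof (cases "y > 0")
    case True
    have eq: "G ((\<lambda>i\<in>{..<n}. 0 + y * u i)(n := y))
      = ennreal (exp (- y)) * (indicator (box 1) u * indicator A u)" if "u \<in> space (?L n)" for u
    proof -
      let ?x = "(\<lambda>i\<in>{..<n}. 0 + y * u i)(n := y)"
      have "(\<lambda>i\<in>{..<n}. ?x i / ?x n) = u"
        using that True by (auto simp: space_PiM PiE_iff extensional_def)
      moreover have "mono_on {..<Suc n} ?x \<and> (\<forall>i<Suc n. 0 \<le> ?x i) \<longleftrightarrow> u \<in> box 1"
        using True by (auto simp: box_def mono_on_def less_Suc_eq zero_le_mult_iff)
      ultimately show ?thesis
        unfolding G_def by (simp add: indicator_def)
    qed
    have "(\<integral>\<^sup>+x. G (x(n := y)) \<partial>?L n)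
      = ennreal (\<Prod>i<n. y) * (\<integral>\<^sup>+u. G ((\<lambda>i\<in>{..<n}. 0 + y * u i)(n := y)) \<partial>?L n)"
    proof (rule nn_integral_PiM_lborel_triangular[OF True, of "\<lambda>_ _. 0"])
      have "(\<lambda>x. x(n := y)) \<in> ?B \<rightarrow>\<^sub>M PiM (insert n {..<n}) (\<lambda>_. borel)"
        by (rule measurable_fun_upd[where J="{..<n}"]) auto
      then have "(\<lambda>x. x(n := y)) \<in> ?B \<rightarrow>\<^sub>M PiM {..<Suc n} (\<lambda>_. borel)"
        by (simp only: lessThan_Suc)
      then show "(\<lambda>x. G (x(n := y))) \<in> borel_measurable ?B"
        by (rule measurable_compose[OF _ G])
    qed simp
    also have "(\<integral>\<^sup>+u. G ((\<lambda>i\<in>{..<n}. 0 + y * u i)(n := y)) \<partial>?L n)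
      = (\<integral>\<^sup>+u. ennreal (exp (- y)) * (indicator (box 1) u * indicator A u) \<partial>?L n)"
      by (rule nn_integral_cong) (rule eq)
    also have "\<dots> = ennreal (exp (- y)) * K"
      unfolding K_def by (rule nn_integral_cmult) measurable
    finally have I: "(\<integral>\<^sup>+x. G (x(n := y)) \<partial>?L n) = ennreal (\<Prod>i<n. y) * (ennreal (exp (- y)) * K)" .
    show ?thesis unfolding I using True by (simp add: ennreal_mult mult.assoc)
  next
    case False
    have "\<not> (\<forall>i<Suc n. 0 \<le> (x(n := y)) i)" for x :: "nat \<Rightarrow> real"
      using False that by (auto intro!: exI[of _ n])
    then have "G (x(n := y)) = 0" for x by (simp add: G_def indicator_def del: fun_upd_apply)
    with False show ?thesis by simp
  qed
  have "emeasure (distr ?E ?B ?r) A = (\<integral>\<^sup>+d. indicator A (?r d) \<partial>?E)"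
    by (subst nn_integral_indicator[symmetric], simp, subst nn_integral_distr) simp_all
  also have "\<dots> = (\<integral>\<^sup>+d. ?e d * indicator A (?r d) \<partial>?L (Suc n))"
    unfolding E by (rule nn_integral_density) measurable
  also have "\<dots> = ennreal (\<Prod>i<Suc n. 1) *
      (\<integral>\<^sup>+d. G (\<lambda>i\<in>{..<Suc n}. c i (restrict d {..<i}) + 1 * d i) \<partial>?L (Suc n))"
    by (simp only: G_sums prod.neutral_const ennreal_1 mult_1)
  also have "\<dots> = (\<integral>\<^sup>+x. G x \<partial>?L (Suc n))"
    by (rule nn_integral_PiM_lborel_triangular[OF _ c G, symmetric]) simp
  also have "\<dots> = (\<integral>\<^sup>+y. \<integral>\<^sup>+x. G (x(n := y)) \<partial>?L n \<partial>lborel)"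
    unfolding lessThan_Suc
  proof (rule lborel_PiM.product_nn_integral_insert_rev)
    show "G \<in> borel_measurable (PiM (insert n {..<n}) (\<lambda>_. lborel))"
      unfolding lessThan_Suc[symmetric] by measurable
  qed auto
  also have "\<dots> = (\<integral>\<^sup>+y. indicator {0<..} y * ennreal (y ^ n * exp (- y)) * K \<partial>lborel)"
    using AE_lborel_singleton[of "0::real"]
    by (intro nn_integral_cong_AE) (auto elim!: eventually_mono intro!: scale)
  also have "\<dots> = fact n * K"
    by (subst nn_integral_multc) (simp_all add: nn_integral_power_times_exp_Ioi)
  finally show "emeasure (distr ?E ?B ?r) A = emeasure (distr ?U ?B (sort_vec n)) A"
    unfolding uniform .
qed

section \<open>Distribution function and cumulative hazard\<close>

text \<open>The open interval makes hypotheses on f strictly between x and y sufficient for bounds on the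
  increment of F.\<close>

lemma df_increment_eq_nn_integral:
  assumes F: "df_with_density F f" and xy: "x < y"
  shows "ennreal (F y - F x) = (\<integral>\<^sup>+z. ennreal (f z) * indicator {x<..<y} z \<partial>lborel)"
proof -
  let ?P = "density lborel (\<lambda>x. ennreal (f x))"
  have f[measurable]: "f \<in> borel_measurable borel" and prob: "prob_space ?P" and Fcdf: "F = cdf ?P"
    using F by (auto simp: df_with_density_def)
  interpret P: prob_space ?P by fact
  interpret real_distribution ?P by standard simp_all
  have "ennreal (F y - F x) = emeasure ?P {x<..y}"
    using xy by (simp add: Fcdf cdf_diff_eq P.emeasure_eq_measure)
  also have "\<dots> = (\<integral>\<^sup>+z. ennreal (f z) * indicator {x<..y} z \<partial>lborel)"
    by (rule emeasure_density) auto
  also have "\<dots> = (\<integral>\<^sup>+z. ennreal (f z) * indicator {x<..<y} z \<partial>lborel)"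
    using AE_lborel_singleton[of y]
    by (intro nn_integral_cong_AE) (auto elim!: eventually_mono simp: indicator_def)
  finally show ?thesis .
qed

lemma df_mono:
  assumes F: "df_with_density F f" and xy: "x \<le> y"
  shows "F x \<le> F y"
proof -
  interpret prob_space "density lborel (\<lambda>x. ennreal (f x))"
    using F by (simp add: df_with_density_def)
  interpret real_distribution "density lborel (\<lambda>x. ennreal (f x))" by standard simp_all
  show ?thesis using F xy by (simp add: df_with_density_def cdf_nondecreasing)
qed

lemma df_increment_le:
  assumes F: "df_with_density F f" and xy: "x < y" and c: "0 \<le> c"
    and le: "\<And>z. x < z \<Longrightarrow> z < y \<Longrightarrow> f z \<le> c"
  shows "F y - F x \<le> c * (y - x)"
proof -
  have "ennreal (F y - F x) \<le> (\<integral>\<^sup>+z. ennreal c * indicator {x<..<y} z \<partial>lborel)"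
    unfolding df_increment_eq_nn_integral[OF F xy]
    using le by (intro nn_integral_mono) (auto simp: indicator_def intro: ennreal_leI)
  also have "\<dots> = ennreal (c * (y - x))"
    using xy c by (simp add: nn_integral_cmult_indicator ennreal_mult)
  finally show ?thesis using c xy by (simp add: ennreal_le_iff)
qed

lemma df_increment_ge:
  assumes F: "df_with_density F f" and xy: "x < y" and c: "0 \<le> c"
    and le: "\<And>z. x < z \<Longrightarrow> z < y \<Longrightarrow> c \<le> f z"
  shows "c * (y - x) \<le> F y - F x"
proof -
  have "ennreal (c * (y - x)) = (\<integral>\<^sup>+z. ennreal c * indicator {x<..<y} z \<partial>lborel)"
    using xy c by (simp add: nn_integral_cmult_indicator ennreal_mult)
  also have "\<dots> \<le> ennreal (F y - F x)"
    unfolding df_increment_eq_nn_integral[OF F xy]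
    using le by (intro nn_integral_mono) (auto simp: indicator_def intro: ennreal_leI)
  finally show ?thesis using df_mono[OF F less_imp_le[OF xy]] by (simp add: ennreal_le_iff)
qed

definition cum_hazard :: "(real \<Rightarrow> real) \<Rightarrow> real \<Rightarrow> real" where
  "cum_hazard F x = - ln (1 - F x)"

lemma borel_measurable_df:
  assumes "df_with_density F f" shows "F \<in> borel_measurable borel"
  using df_mono[OF assms] by (intro borel_measurable_mono monoI)

lemma borel_measurable_cum_hazard:
  assumes "df_with_density F f" shows "cum_hazard F \<in> borel_measurable borel"
  using borel_measurable_df[OF assms] unfolding cum_hazard_def[abs_def] by measurable

lemma df_eq_zero:
  assumes F: "df_with_density F f" and x: "x \<le> 0"
  shows "F x = 0"
proof -
  let ?P = "density lborel (\<lambda>x. ennreal (f x))"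
  have f[measurable]: "f \<in> borel_measurable borel" and z: "\<And>x. x \<le> 0 \<Longrightarrow> f x = 0" and Fcdf: "F = cdf ?P"
    using F by (auto simp: df_with_density_def)
  have "emeasure ?P {..x} = (\<integral>\<^sup>+y. 0 \<partial>(lborel :: real measure))"
  proof (subst emeasure_density)
    show "(\<integral>\<^sup>+y. ennreal (f y) * indicator {..x} y \<partial>lborel) = (\<integral>\<^sup>+y. 0 \<partial>(lborel :: real measure))"
    proof (rule nn_integral_cong)
      fix y show "ennreal (f y) * indicator {..x} y = 0" using x z[of y] by (cases "y \<le> x") auto
    qed
  qed auto
  then show ?thesis by (simp add: Fcdf cdf_def measure_def)
qed

lemma df_props:
  assumes F: "df_with_density F f"
  shows "continuous_on A F" and "(F \<longlongrightarrow> 1) at_top" and "F x \<le> 1" and "0 \<le> F x"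
proof -
  let ?P = "density lborel (\<lambda>x. ennreal (f x))"
  have f[measurable]: "f \<in> borel_measurable borel" and prob: "prob_space ?P" and Fcdf: "F = cdf ?P"
    using F by (auto simp: df_with_density_def)
  interpret P: prob_space ?P by fact
  interpret real_distribution ?P by standard simp_all
  have "isCont F x" for x
    by (simp add: Fcdf isCont_cdf measure_def emeasure_density_lborel_singleton)
  then show "continuous_on A F" by (simp add: continuous_at_imp_continuous_on)
  show "(F \<longlongrightarrow> 1) at_top" unfolding Fcdf by (rule cdf_lim_at_top_prob)
  show "F x \<le> 1" unfolding Fcdf by (rule cdf_bounded_prob)
  show "0 \<le> F x" unfolding Fcdf by (rule cdf_nonneg)
qed

text \<open>Sublevel sets of a continuous distribution function are half-lines whose endpoint attains the
  level. This gives the probability integral transform, and for \<open>t = 0\<close> the left endpoint.\<close>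

lemma df_sublevel:
  assumes F: "df_with_density F f" and t: "0 \<le> t" "t < 1"
  obtains s where "F s = t" "{x. F x \<le> t} = {..s}"
proof -
  have "eventually (\<lambda>x. t < F x) at_top"
    using order_tendstoD(1)[OF df_props(2)[OF F] t(2)] .
  then obtain z where z: "\<And>x. z \<le> x \<Longrightarrow> t < F x" by (auto simp: eventually_at_top_linorder)
  let ?A = "{x. F x \<le> t}"
  have "closed ?A" by (intro closed_Collect_le continuous_on_const df_props(1)[OF F])
  moreover have 0: "0 \<in> ?A" using t df_eq_zero[OF F] by simp
  moreover have bdd: "bdd_above ?A" 
    using z by (intro bdd_aboveI[of _ z]) (metis linorder_le_cases mem_Collect_eq not_le)
  ultimately have s: "Sup ?A \<in> ?A" using closed_contains_Sup[of ?A] by blast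
  have eq: "?A = {..Sup ?A}"
    using df_mono[OF F] s bdd by (auto intro: cSup_upper order_trans)
  have "0 \<le> max 0 z" "F 0 \<le> t" "t \<le> F (max 0 z)" using 0 z[of "max 0 z"] by auto
  then obtain u where "F u = t" using IVT'[of F 0 t "max 0 z"] df_props(1)[OF F] by blast
  moreover have "u \<le> Sup ?A" using \<open>F u = t\<close> bdd by (intro cSup_upper) auto
  ultimately have "F (Sup ?A) = t" using s df_mono[OF F, of u "Sup ?A"] by auto
  with eq show thesis using that by blast
qed

text \<open>The largest zero of F is a point of increase, and no point to its left is one.\<close>

lemma df_left_endpoint:
  assumes F: "df_with_density F f"
  shows "F (left_endpoint F) = 0"
proof -
  obtain s where s: "F s = 0" "{x. F x \<le> 0} = {..s}" using df_sublevel[OF F, of 0] by auto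
  have pos: "0 < F x \<longleftrightarrow> s < x" for x
    using s(2) by (auto simp: set_eq_iff not_le[symmetric])
  have zero: "F x = 0 \<longleftrightarrow> x \<le> s" for x using pos[of x] df_props(4)[OF F, of x] by linarith
  have "Inf (df_support F) = s"
  proof (rule cInf_eq_minimum)
    show "s \<in> df_support F"
      unfolding df_support_def
    proof (intro CollectI allI impI)
      fix e :: real assume "0 < e"
      then show "F (s - e) < F (s + e)" using zero[of "s - e"] pos[of "s + e"] by simp
    qed
    fix x assume "x \<in> df_support F"
    show "s \<le> x"
    proof (rule ccontr)
      assume "\<not> s \<le> x"
      then have "0 < s - x" by simp
      moreover have "\<forall>e>0. F (x - e) < F (x + e)"
        using \<open>x \<in> df_support F\<close> by (simp add: df_support_def)
      ultimately have "F (x - (s - x)) < F (x + (s - x))" by blast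
      with s(1) df_props(4)[OF F, of "x - (s - x)"] show False by simp
    qed
  qed
  then show ?thesis by (simp add: left_endpoint_def s(1))
qed

text \<open>The probability integral transform: \<open>F \<le> t\<close> has probability t for \<open>0 \<le> t < 1\<close>. Letting t tend to
  1 shows that \<open>F = 1\<close> has probability 0, and \<open>t = 1 - exp (- a)\<close> gives the exponential law of the
  cumulative hazard.\<close>

lemma
  assumes F: "df_with_density F f"
  shows AE_df_less_1: "AE x in density lborel (\<lambda>x. ennreal (f x)). F x < 1"
    and distr_cum_hazard: "distr (density lborel (\<lambda>x. ennreal (f x))) borel (cum_hazard F) = exp_law"
proof -
  let ?P = "density lborel (\<lambda>x. ennreal (f x))"
  have f[measurable]: "f \<in> borel_measurable borel" and prob: "prob_space ?P" and Fcdf: "F = cdf ?P"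
    using F by (auto simp: df_with_density_def)
  interpret P: prob_space ?P by fact
  note [measurable] = borel_measurable_df[OF F] borel_measurable_cum_hazard[OF F]
  have le: "measure ?P {x. F x \<le> t} = t" if t: "0 \<le> t" "t < 1" for t
  proof -
    obtain s where "F s = t" "{x. F x \<le> t} = {..s}" using df_sublevel[OF F t] by blast
    then show ?thesis by (simp add: Fcdf cdf_def)
  qed
  have "P.prob {x. F x < 1} = 1"
  proof (rule antisym)
    show "1 \<le> P.prob {x. F x < 1}"
    proof (rule dense_le_bounded[of 0])
      fix t :: real assume t: "0 < t" "t < 1"
      have "t = P.prob {x. F x \<le> t}" using le t by simp
      also have "\<dots> \<le> P.prob {x. F x < 1}" using t by (intro P.finite_measure_mono) auto
      finally show "t \<le> P.prob {x. F x < 1}" .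
    qed simp
  qed simp
  then show AE: "AE x in ?P. F x < 1"
    using P.prob_Collect_eq_1[of "\<lambda>x. F x < 1"] by simp
  have "distributed ?P lborel (cum_hazard F) (\<lambda>x. ennreal (exponential_density 1 x))"
  proof (subst P.exponential_distributed_iff[OF zero_less_one], intro conjI allI impI)
    fix a :: real assume a: "0 \<le> a"
    have "P.prob {x \<in> space ?P. cum_hazard F x \<le> a} = P.prob {x. F x \<le> 1 - exp (- a)}"
    proof (rule P.finite_measure_eq_AE)
      show "AE x in ?P. x \<in> {x \<in> space ?P. cum_hazard F x \<le> a} \<longleftrightarrow> x \<in> {x. F x \<le> 1 - exp (- a)}"
        using AE
      proof eventually_elim
        case (elim x)
        have "cum_hazard F x \<le> a \<longleftrightarrow> - a \<le> ln (1 - F x)" by (auto simp: cum_hazard_def)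
        also have "\<dots> \<longleftrightarrow> exp (- a) \<le> 1 - F x" using elim by (simp add: ln_ge_iff)
        finally show ?case by auto
      qed
    qed auto
    also have "\<dots> = 1 - exp (- a)" using a by (intro le) auto
    finally show "P.prob {x \<in> space ?P. cum_hazard F x \<le> a} = 1 - exp (- a * 1)" by simp
  qed auto
  from distributed_distr_eq_density[OF this]
  have "distr ?P lborel (cum_hazard F) = exp_law" .
  moreover have "distr ?P lborel (cum_hazard F) = distr ?P borel (cum_hazard F)"
    by (rule distr_cong) auto
  ultimately show "distr ?P borel (cum_hazard F) = exp_law" by simp
qed

section \<open>The failure rate as the slope of the cumulative hazard\<close>

text \<open>A discrete Gronwall argument: cut \<open>[a, b]\<close> into n equal pieces, multiply the step bounds and let
  n grow. It replaces differentiation, since F need not be differentiable everywhere.\<close>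

lemma exponential_growth_from_steps:
  fixes g :: "real \<Rightarrow> real"
  assumes ab: "a < b"
    and step: "\<And>x y. a \<le> x \<Longrightarrow> x < y \<Longrightarrow> y \<le> b \<Longrightarrow> (1 + s * (y - x)) * g x \<le> g y"
  shows "exp (s * (b - a)) * g a \<le> g b"
proof (rule LIMSEQ_le_const2)
  show "(\<lambda>n. (1 + s * (b - a) / real n) ^ n * g a) \<longlonglongrightarrow> exp (s * (b - a)) * g a"
    by (intro tendsto_mult tendsto_exp_limit_sequentially tendsto_const)
  \<comment> \<open>For large n the step factor \<open>1 + s (b - a) / n\<close> is positive, so that steps may be multiplied.\<close>
  obtain N :: nat where N: "\<bar>s\<bar> * (b - a) < N" using reals_Archimedean2 by blast
  show "\<exists>N. \<forall>n\<ge>N. (1 + s * (b - a) / real n) ^ n * g a \<le> g b"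
  proof (intro exI[of _ "Suc N"] allI impI)
    fix n assume "Suc N \<le> n"
    then have n: "\<bar>s\<bar> * (b - a) < real n" "0 < real n" using N by auto
    define \<delta> where "\<delta> = (b - a) / real n"
    have \<delta>: "0 < \<delta>" "real n * \<delta> = b - a" using ab n by (auto simp: \<delta>_def)
    have "- s * (b - a) \<le> \<bar>s\<bar> * (b - a)" using ab by (intro mult_right_mono) auto
    then have pos: "0 \<le> 1 + s * \<delta>"
      using n by (simp add: \<delta>_def field_simps)
    have "(1 + s * \<delta>) ^ i * g a \<le> g (a + real i * \<delta>)" if "i \<le> n" for i
      using that
    proof (induction i)
      case (Suc i)
      have "real (Suc i) * \<delta> \<le> real n * \<delta>" using Suc.prems \<delta> by (intro mult_right_mono) auto
      then have le: "a + real (Suc i) * \<delta> \<le> b" using \<delta> by simp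
      have "(1 + s * \<delta>) ^ Suc i * g a = (1 + s * \<delta>) * ((1 + s * \<delta>) ^ i * g a)" by simp
      also have "\<dots> \<le> (1 + s * \<delta>) * g (a + real i * \<delta>)"
        using Suc pos by (intro mult_left_mono) auto
      also have "\<dots> \<le> g (a + real (Suc i) * \<delta>)"
        using step[of "a + real i * \<delta>" "a + real (Suc i) * \<delta>"] \<delta> le by (simp add: algebra_simps)
      finally show ?case .
    qed simp
    from this[of n] show "(1 + s * (b - a) / real n) ^ n * g a \<le> g b"
      using \<delta> by (simp add: \<delta>_def)
  qed
qed

lemma failure_rate_nonneg:
  assumes F: "df_with_density F f" and "F z < 1"
  shows "0 \<le> failure_rate F f z"
  using assms by (simp add: failure_rate_def df_with_density_def)

text \<open>A failure rate of at most h means that the survival function \<open>1 - F\<close> decays at most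
  exponentially with rate h.\<close>

lemma cum_hazard_increment_le:
  assumes F: "df_with_density F f" and ab: "a < b" and b: "F b < 1" and h: "0 \<le> h"
    and rate: "\<And>z. a < z \<Longrightarrow> z < b \<Longrightarrow> failure_rate F f z \<le> h"
  shows "cum_hazard F b - cum_hazard F a \<le> h * (b - a)"
proof -
  have lt1: "F z < 1" if "z \<le> b" for z using df_mono[OF F that] b by simp
  have "exp (- h * (b - a)) * (1 - F a) \<le> 1 - F b"
  proof (rule exponential_growth_from_steps[OF ab])
    fix x y assume xy: "a \<le> x" "x < y" "y \<le> b"
    have "F y - F x \<le> h * (1 - F x) * (y - x)"
    proof (rule df_increment_le[OF F xy(2)])
      show "0 \<le> h * (1 - F x)" using h lt1[of x] xy by simp
      fix z assume z: "x < z" "z < y"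
      have "f z \<le> h * (1 - F z)"
        using rate[of z] lt1[of z] xy z by (simp add: failure_rate_def divide_le_eq)
      also have "\<dots> \<le> h * (1 - F x)"
        using df_mono[OF F, of x z] z h by (intro mult_left_mono) auto
      finally show "f z \<le> h * (1 - F x)" .
    qed
    then show "(1 + - h * (y - x)) * (1 - F x) \<le> 1 - F y" by (simp add: algebra_simps)
  qed
  then have "ln (exp (- h * (b - a)) * (1 - F a)) \<le> ln (1 - F b)"
    using lt1[of a] ab b by (subst ln_le_cancel_iff) auto
  then show ?thesis using lt1[of a] ab by (simp add: ln_mult cum_hazard_def)
qed

text \<open>Read from right to left, \<open>1 - F\<close> grows at least exponentially with rate h. Hence the reflection
  of the interval in the proof.\<close>

lemma cum_hazard_increment_ge:
  assumes F: "df_with_density F f" and ab: "a < b" and b: "F b < 1" and h: "0 \<le> h"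
    and rate: "\<And>z. a < z \<Longrightarrow> z < b \<Longrightarrow> h \<le> failure_rate F f z"
  shows "h * (b - a) \<le> cum_hazard F b - cum_hazard F a"
proof -
  have lt1: "F z < 1" if "z \<le> b" for z using df_mono[OF F that] b by simp
  have "exp (h * (- a - (- b))) * (1 - F (- (- b))) \<le> 1 - F (- (- a))"
  proof (rule exponential_growth_from_steps[where g = "\<lambda>x. 1 - F (- x)"])
    show "- b < - a" using ab by simp
    fix x y assume xy: "- b \<le> x" "x < y" "y \<le> - a"
    have "h * (1 - F (- x)) * (- x - (- y)) \<le> F (- x) - F (- y)"
    proof (rule df_increment_ge[OF F])
      show "0 \<le> h * (1 - F (- x))" using h lt1[of "- x"] xy by simp
      fix z assume z: "- y < z" "z < - x"
      have "h * (1 - F (- x)) \<le> h * (1 - F z)"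
        using df_mono[OF F, of z "- x"] z h by (intro mult_left_mono) auto
      also have "\<dots> \<le> f z"
        using rate[of z] lt1[of z] xy z by (simp add: failure_rate_def le_divide_eq)
      finally show "h * (1 - F (- x)) \<le> f z" .
    qed (use xy in simp)
    then show "(1 + h * (y - x)) * (1 - F (- x)) \<le> 1 - F (- y)" by (simp add: algebra_simps)
  qed
  then have "ln (exp (h * (b - a)) * (1 - F b)) \<le> ln (1 - F a)"
    using lt1[of a] ab b by (subst ln_le_cancel_iff) auto
  then show ?thesis using b by (simp add: ln_mult cum_hazard_def)
qed

section \<open>Comparison of the statistics\<close>

text \<open>If the ratio \<open>d' / d\<close> increases, then \<open>d'\<close> puts relatively less mass on an initial segment of
  indices. Multiplying out, it is enough to compare each index of the initial segment with each later
  one.\<close>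

lemma partial_sum_fraction_le:
  fixes d d' :: "nat \<Rightarrow> real"
  assumes ij: "j < i" "i < k"
    and pos: "\<And>l. j < l \<Longrightarrow> l \<le> k \<Longrightarrow> 0 < d l \<and> 0 < d' l"
    and lr: "\<And>l. j < l \<Longrightarrow> l < k \<Longrightarrow> d' l * d (Suc l) \<le> d' (Suc l) * d l"
  shows "(\<Sum>l=j+1..i. d' l) / (\<Sum>l=j+1..k. d' l) \<le> (\<Sum>l=j+1..i. d l) / (\<Sum>l=j+1..k. d l)"
proof -
  \<comment> \<open>The comparison of neighbours extends to arbitrary pairs of indices.\<close>
  have lr': "d' l / d l \<le> d' m / d m" if "j < l" "l \<le> m" "m \<le> k" for l m
    using that(2,3)
  proof (induction m rule: dec_induct)
    case (step m)
    then have "d' l / d l \<le> d' m / d m" by simp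
    also have "\<dots> \<le> d' (Suc m) / d (Suc m)"
      using lr[of m] pos[of m] pos[of "Suc m"] step that(1) by (simp add: field_simps)
    finally show ?case .
  qed simp
  define A A' B B' where "A = (\<Sum>l=j+1..i. d l)" and "A' = (\<Sum>l=j+1..i. d' l)"
    and "B = (\<Sum>l=i+1..k. d l)" and "B' = (\<Sum>l=i+1..k. d' l)"
  have "A' * B = (\<Sum>l=j+1..i. \<Sum>m=i+1..k. d' l * d m)"
    by (simp add: A'_def B_def sum_product)
  also have "\<dots> \<le> (\<Sum>l=j+1..i. \<Sum>m=i+1..k. d l * d' m)"
  proof (intro sum_mono)
    fix l m assume lm: "l \<in> {j+1..i}" "m \<in> {i+1..k}"
    then show "d' l * d m \<le> d l * d' m"
      using lr'[of l m] pos[of l] pos[of m] ij by (simp add: field_simps)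
  qed
  also have "\<dots> = A * B'" by (simp add: A_def B'_def sum_product)
  finally have AB: "A' * B \<le> A * B'" .
  have split: "(\<Sum>l=j+1..k. g l) = (\<Sum>l=j+1..i. g l) + (\<Sum>l=i+1..k. g l)" for g :: "nat \<Rightarrow> real"
    using ij sum.ub_add_nat[of "j+1" i g "k - i"] by simp
  have "0 < A" "0 < A'" "0 < B" "0 < B'"
    unfolding A_def A'_def B_def B'_def using ij pos by (intro sum_pos; auto)+
  then show ?thesis
    unfolding split A_def[symmetric] A'_def[symmetric] B_def[symmetric] B'_def[symmetric]
    using AB by (simp add: field_simps)
qed

lemma beta_fun_mono:
  "0 < x \<Longrightarrow> x \<le> y \<Longrightarrow> y < 1 \<Longrightarrow> beta_fun x \<le> beta_fun y"
  by (simp add: beta_fun_def)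

lemma norm_spacing_ratio_fraction:
  assumes jk: "j < k" "k \<le> n + 1" "j \<le> i"
    and total: "(\<Sum>l=1..n + 1. norm_spacing n x l) \<noteq> 0"
  shows "(norm_spacing_ratio n x i - norm_spacing_ratio n x j)
      / (norm_spacing_ratio n x k - norm_spacing_ratio n x j)
    = (\<Sum>l=j+1..i. norm_spacing n x l) / (\<Sum>l=j+1..k. norm_spacing n x l)"
proof -
  have "norm_spacing_ratio n x m - norm_spacing_ratio n x j
    = (\<Sum>l=j+1..m. norm_spacing n x l) / (\<Sum>l=1..n + 1. norm_spacing n x l)" if "j \<le> m" for m
    using that sum.ub_add_nat[of 1 j "norm_spacing n x" "m - j"]
    by (simp add: norm_spacing_ratio_def diff_divide_distrib[symmetric])
  then show ?thesis using jk total by simp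
qed

text \<open>The hypothesis on the increments is that the slopes of \<open>x'\<close> against x increase, in a form
  symmetric in x and \<open>x'\<close>; exchanging the two vectors gives the case of decreasing slopes.\<close>

lemma T_stat_norm_spacing_ratio_le:
  assumes jk: "j < k" "k \<le> n + 1"
    and incr: "\<And>l. l \<le> n \<Longrightarrow> x l < x (Suc l)" "\<And>l. l \<le> n \<Longrightarrow> x' l < x' (Suc l)"
    and lr: "\<And>l. j < l \<Longrightarrow> l < k \<Longrightarrow>
      (x' l - x' (l - 1)) * (x (Suc l) - x l) \<le> (x' (Suc l) - x' l) * (x l - x (l - 1))"
  shows "T_stat j k (norm_spacing_ratio n x') \<le> T_stat j k (norm_spacing_ratio n x)"
proof -
  have pos: "0 < norm_spacing n y l" if "0 < l" "l \<le> n + 1" "\<And>l. l \<le> n \<Longrightarrow> y l < y (Suc l)"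
    for y :: "nat \<Rightarrow> real" and l
    using that(1,2) that(3)[of "l - 1"] by (simp add: norm_spacing_def)
  have px: "0 < norm_spacing n x l" and px': "0 < norm_spacing n x' l" if "0 < l" "l \<le> n + 1" for l
    using that incr by (auto intro!: pos)
  have tot: "(\<Sum>l=1..n + 1. norm_spacing n x l) \<noteq> 0" "(\<Sum>l=1..n + 1. norm_spacing n x' l) \<noteq> 0"
    using sum_pos[of "{1..n + 1}" "norm_spacing n x"] sum_pos[of "{1..n + 1}" "norm_spacing n x'"]
      px px' by fastforce+
  have lr': "norm_spacing n x' l * norm_spacing n x (Suc l) \<le> norm_spacing n x' (Suc l) * norm_spacing n x l"
    if "j < l" "l < k" for l
  proof -
    have "0 \<le> (real n - real l + 2) * (real n - real (Suc l) + 2)" using that jk by simp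
    from mult_left_mono[OF lr[OF that] this] show ?thesis
      by (simp add: norm_spacing_def mult_ac)
  qed
  show ?thesis
    unfolding T_stat_def
  proof (rule sum_mono)
    fix i assume "i \<in> {j + 1..k - 1}"
    then have i: "j < i" "i < k" by auto
    let ?S = "\<lambda>y a b. \<Sum>l=a..b. norm_spacing n y l"
    have le: "?S x' (j+1) i / ?S x' (j+1) k \<le> ?S x (j+1) i / ?S x (j+1) k"
      using i jk px px' lr' by (intro partial_sum_fraction_le) auto
    have "0 < ?S x' (j+1) i" "0 < ?S x' (j+1) k"
      using i jk px' by (intro sum_pos; auto)+
    then have gt0: "0 < ?S x' (j+1) i / ?S x' (j+1) k" by simp
    have "?S x (j+1) k = ?S x (j+1) i + ?S x (i+1) k"
      using i sum.ub_add_nat[of "j+1" i "norm_spacing n x" "k - i"] by simp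
    moreover have "0 < ?S x (j+1) i" "0 < ?S x (i+1) k"
      using i jk px by (intro sum_pos; auto)+
    ultimately have "?S x (j+1) i / ?S x (j+1) k < 1" by simp
    with gt0 le have "beta_fun (?S x' (j+1) i / ?S x' (j+1) k) \<le> beta_fun (?S x (j+1) i / ?S x (j+1) k)"
      by (intro beta_fun_mono)
    then show "beta_fun ((norm_spacing_ratio n x' i - norm_spacing_ratio n x' j)
        / (norm_spacing_ratio n x' k - norm_spacing_ratio n x' j))
      \<le> beta_fun ((norm_spacing_ratio n x i - norm_spacing_ratio n x j)
        / (norm_spacing_ratio n x k - norm_spacing_ratio n x j))"
      unfolding norm_spacing_ratio_fraction[OF jk less_imp_le[OF i(1)] tot(1)]
        norm_spacing_ratio_fraction[OF jk less_imp_le[OF i(1)] tot(2)] .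
  qed
qed

text \<open>At an inner node \<open>x l\<close> the value h of the failure rate separates the two adjacent slopes of the
  cumulative hazard: in the monotone case h bounds the left slope from above and the right slope
  from below, in the antitone case the other way round.\<close>

lemma T_stat_compare_cum_hazard:
  fixes x :: "nat \<Rightarrow> real"
  assumes F: "df_with_density F f" and jk: "j < k" "k \<le> n + 1"
    and lt1: "\<And>l. l \<le> n + 1 \<Longrightarrow> F (x l) < 1"
    and incr: "\<And>l. l \<le> n \<Longrightarrow> cum_hazard F (x l) < cum_hazard F (x (Suc l))"
  shows "mono_on {x j<..<x k} (failure_rate F f) \<Longrightarrow>
      T_stat j k (norm_spacing_ratio n (\<lambda>l. cum_hazard F (x l))) \<le> T_stat j k (norm_spacing_ratio n x)"
    and "antimono_on {x j<..<x k} (failure_rate F f) \<Longrightarrow>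
      T_stat j k (norm_spacing_ratio n x) \<le> T_stat j k (norm_spacing_ratio n (\<lambda>l. cum_hazard F (x l)))"
proof -
  have incr_x: "x l < x (Suc l)" if "l \<le> n" for l
  proof (rule ccontr)
    assume "\<not> x l < x (Suc l)"
    then have "F (x (Suc l)) \<le> F (x l)" by (intro df_mono[OF F]) simp
    with incr[OF that] lt1[of l] lt1[of "Suc l"] that show False by (simp add: cum_hazard_def)
  qed
  have less: "x a < x b" if "a < b" "b \<le> n + 1" for a b
    using that
  proof (induction b)
    case (Suc b)
    then show ?case using incr_x[of b] by (cases "a = b") auto
  qed simp
  have le: "x a \<le> x b" if "a \<le> b" "b \<le> n + 1" for a b
    using less[of a b] that by (cases "a = b") auto
  have inside: "z \<in> {x j<..<x k}" if "j < l" "l < k" "x (l - 1) < z" "z < x (Suc l)" for l z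
  proof -
    have "x j \<le> x (l - 1)" "x (Suc l) \<le> x k" using that jk by (intro le; simp)+
    with that show ?thesis by simp
  qed
  have nodes: "x (l - 1) < x l" "x l < x (Suc l)" "F (x l) < 1" "F (x (Suc l)) < 1"
      "0 \<le> failure_rate F f (x l)" if "j < l" "l < k" for l
    using that jk less[of "l - 1" l] less[of l "Suc l"] lt1[of l] lt1[of "Suc l"]
      failure_rate_nonneg[OF F, of "x l"] by auto
  let ?c = "\<lambda>l. cum_hazard F (x l)"
  {
    assume mono: "mono_on {x j<..<x k} (failure_rate F f)"
    have "(?c l - ?c (l - 1)) * (x (Suc l) - x l) \<le> (?c (Suc l) - ?c l) * (x l - x (l - 1))"
      if l: "j < l" "l < k" for l
    proof -
      note n = nodes[OF l]
      let ?h = "failure_rate F f (x l)"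
      have xl: "x l \<in> {x j<..<x k}" using inside[OF l] n by blast
      have up: "?c l - ?c (l - 1) \<le> ?h * (x l - x (l - 1))"
      proof (rule cum_hazard_increment_le[OF F])
        fix z assume "x (l - 1) < z" "z < x l"
        then show "failure_rate F f z \<le> ?h"
          using inside[OF l, of z] n xl by (intro mono_onD[OF mono]) auto
      qed (use n in auto)
      have lo: "?h * (x (Suc l) - x l) \<le> ?c (Suc l) - ?c l"
      proof (rule cum_hazard_increment_ge[OF F])
        fix z assume "x l < z" "z < x (Suc l)"
        then show "?h \<le> failure_rate F f z"
          using inside[OF l, of z] n xl by (intro mono_onD[OF mono]) auto
      qed (use n in auto)
      have "(?c l - ?c (l - 1)) * (x (Suc l) - x l) \<le> (?h * (x l - x (l - 1))) * (x (Suc l) - x l)"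
        using up n by (intro mult_right_mono) auto
      also have "\<dots> = (?h * (x (Suc l) - x l)) * (x l - x (l - 1))" by simp
      also have "\<dots> \<le> (?c (Suc l) - ?c l) * (x l - x (l - 1))"
        using lo n by (intro mult_right_mono) auto
      finally show ?thesis .
    qed
    then show "T_stat j k (norm_spacing_ratio n ?c) \<le> T_stat j k (norm_spacing_ratio n x)"
      using incr incr_x by (intro T_stat_norm_spacing_ratio_le[OF jk])
  next
    assume anti: "antimono_on {x j<..<x k} (failure_rate F f)"
    have antiD: "failure_rate F f b \<le> failure_rate F f a"
      if "a \<in> {x j<..<x k}" "b \<in> {x j<..<x k}" "a \<le> b" for a b
      using anti that by (auto simp: monotone_on_def)
    have "(x l - x (l - 1)) * (?c (Suc l) - ?c l) \<le> (x (Suc l) - x l) * (?c l - ?c (l - 1))"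
      if l: "j < l" "l < k" for l
    proof -
      note n = nodes[OF l]
      let ?h = "failure_rate F f (x l)"
      have xl: "x l \<in> {x j<..<x k}" using inside[OF l] n by blast
      have lo: "?h * (x l - x (l - 1)) \<le> ?c l - ?c (l - 1)"
      proof (rule cum_hazard_increment_ge[OF F])
        fix z assume "x (l - 1) < z" "z < x l"
        then show "?h \<le> failure_rate F f z"
          using inside[OF l, of z] n xl by (intro antiD) auto
      qed (use n in auto)
      have up: "?c (Suc l) - ?c l \<le> ?h * (x (Suc l) - x l)"
      proof (rule cum_hazard_increment_le[OF F])
        fix z assume "x l < z" "z < x (Suc l)"
        then show "failure_rate F f z \<le> ?h"
          using inside[OF l, of z] n xl by (intro antiD) auto
      qed (use n in auto)
      have "(x l - x (l - 1)) * (?c (Suc l) - ?c l) \<le> (x l - x (l - 1)) * (?h * (x (Suc l) - x l))"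
        using up n by (intro mult_left_mono) auto
      also have "\<dots> = (x (Suc l) - x l) * (?h * (x l - x (l - 1)))" by simp
      also have "\<dots> \<le> (x (Suc l) - x l) * (?c l - ?c (l - 1))"
        using lo n by (intro mult_left_mono) auto
      finally show ?thesis .
    qed
    then show "T_stat j k (norm_spacing_ratio n x) \<le> T_stat j k (norm_spacing_ratio n ?c)"
      using incr incr_x by (intro T_stat_norm_spacing_ratio_le[OF jk])
  }
qed

section \<open>Samples and their order statistics\<close>

lemma iid_sample_measurable:
  assumes "prob_space M" "iid_sample M m \<mu> Y" "i < m"
  shows "Y i \<in> borel_measurable M"
  using assms prob_space.indep_vars_def[of M "\<lambda>_. borel" Y "{..<m}"] by (auto simp: iid_sample_def)

lemma distr_iid_sample:
  assumes M: "prob_space M" and Y: "iid_sample M m \<mu> Y"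
  shows "distr M (PiM {..<m} (\<lambda>_. borel)) (\<lambda>\<omega>. \<lambda>i\<in>{..<m}. Y i \<omega>) = PiM {..<m} (\<lambda>_. \<mu>)"
proof (cases "m = 0")
  case True
  interpret prob_space M by fact
  \<comment> \<open>The empty sample has a deterministic law, the point mass at the empty vector.\<close>
  have "(\<lambda>\<omega>. \<lambda>i\<in>{..<m}. Y i \<omega>) = (\<lambda>_ _. undefined)" using True by (auto simp: fun_eq_iff)
  then have "distr M (PiM {..<m} (\<lambda>_. borel)) (\<lambda>\<omega>. \<lambda>i\<in>{..<m}. Y i \<omega>)
    = return (PiM {..<m} (\<lambda>_. borel)) (\<lambda>_. undefined)"
    using True by (simp add: distr_const PiM_empty)
  also have "\<dots> = PiM {..<m} (\<lambda>_. \<mu>)"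
    using True by (intro measure_eqI) (auto simp: PiM_empty emeasure_return indicator_def subset_singleton_iff)
  finally show ?thesis .
next
  case False
  interpret prob_space M by fact
  have "{..<m} \<noteq> {}" using False by auto
  from indep_vars_iff_distr_eq_PiM'[OF this, of Y "\<lambda>_. borel"] Y iid_sample_measurable[OF M Y]
  have "distr M (PiM {..<m} (\<lambda>_. borel)) (\<lambda>\<omega>. \<lambda>i\<in>{..<m}. Y i \<omega>)
    = PiM {..<m} (\<lambda>i. distr M borel (Y i))"
    by (simp add: iid_sample_def)
  also have "\<dots> = PiM {..<m} (\<lambda>_. \<mu>)"
    using Y by (intro PiM_cong) (auto simp: iid_sample_def)
  finally show ?thesis .
qed

lemma iid_sample_cum_hazard:
  assumes M: "prob_space M" and F: "df_with_density F f"
    and Y: "iid_sample M m (density lborel (\<lambda>x. ennreal (f x))) Y"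
  shows "iid_sample M m exp_law (\<lambda>l \<omega>. cum_hazard F (Y l \<omega>))"
proof -
  interpret prob_space M by fact
  note [measurable] = borel_measurable_cum_hazard[OF F]
  have "indep_vars (\<lambda>_. borel) (\<lambda>l \<omega>. cum_hazard F (Y l \<omega>)) {..<m}"
    by (rule indep_vars_compose2[where X = Y and M' = "\<lambda>_. borel"])
       (use Y borel_measurable_cum_hazard[OF F] in \<open>simp_all add: iid_sample_def\<close>)
  moreover have "distr M borel (\<lambda>\<omega>. cum_hazard F (Y i \<omega>)) = exp_law" if "i < m" for i
  proof -
    have "distr M borel (\<lambda>\<omega>. cum_hazard F (Y i \<omega>)) = distr (distr M borel (Y i)) borel (cum_hazard F)"
      using iid_sample_measurable[OF M Y that] by (subst distr_distr) (auto simp: comp_def)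
    then show ?thesis
      using Y that distr_cum_hazard[OF F] by (simp add: iid_sample_def)
  qed
  ultimately show ?thesis by (simp add: iid_sample_def)
qed

lemma sort_map_mono_on:
  "mono_on (set xs) f \<Longrightarrow> sort (map f xs) = map f (sort xs)"
  by (rule properties_for_sort) (auto intro!: sorted_map_mono)

text \<open>The cumulative hazard is increasing only where \<open>F < 1\<close>: beyond, the convention \<open>ln 0 = 0\<close> makes
  it drop to 0.\<close>

lemma sort_vec_cum_hazard:
  assumes F: "df_with_density F f" and lt1: "\<And>l. l < m \<Longrightarrow> F (x l) < 1" and i: "i < m"
  shows "sort_vec m (\<lambda>l\<in>{..<m}. cum_hazard F (x l)) i = cum_hazard F (sort (map x [0..<m]) ! i)"
    and "F (sort (map x [0..<m]) ! i) < 1"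
proof -
  have "mono_on (set (map x [0..<m])) (cum_hazard F)"
    using lt1 df_mono[OF F] by (intro mono_onI) (auto simp: cum_hazard_def)
  from sort_map_mono_on[OF this]
  have "sort (map (\<lambda>l. cum_hazard F (x l)) [0..<m]) = map (cum_hazard F) (sort (map x [0..<m]))"
    by (simp add: comp_def)
  moreover have "map (\<lambda>l\<in>{..<m}. cum_hazard F (x l)) [0..<m] = map (\<lambda>l. cum_hazard F (x l)) [0..<m]"
    by simp
  ultimately show "sort_vec m (\<lambda>l\<in>{..<m}. cum_hazard F (x l)) i = cum_hazard F (sort (map x [0..<m]) ! i)"
    using i by (simp add: sort_vec_def del: map_eq_conv)
  have "sort (map x [0..<m]) ! i \<in> set (sort (map x [0..<m]))" using i by (intro nth_mem) simp
  then show "F (sort (map x [0..<m]) ! i) < 1" using lt1 by auto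
qed

lemma measurable_sample_vec:
  assumes "prob_space M" "iid_sample M m \<mu> Y"
  shows "(\<lambda>\<omega>. \<lambda>l\<in>{..<m}. Y l \<omega>) \<in> M \<rightarrow>\<^sub>M PiM {..<m} (\<lambda>_. borel)"
  using iid_sample_measurable[OF assms] by (intro measurable_restrict) auto

lemma order_stat_eq_sort_vec:
  assumes "i < m" shows "order_stat m Y i \<omega> = sort_vec m (\<lambda>l\<in>{..<m}. Y l \<omega>) i"
proof -
  have "map (\<lambda>l\<in>{..<m}. Y l \<omega>) [0..<m] = map (\<lambda>l. Y l \<omega>) [0..<m]" by simp
  then show ?thesis using assms by (simp add: order_stat_def sort_vec_def del: map_eq_conv)
qed

lemma measurable_order_stat:
  assumes "prob_space M" "iid_sample M m \<mu> Y" "i < m"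
  shows "order_stat m Y i \<in> borel_measurable M"
proof -
  have "(\<lambda>\<omega>. sort_vec m (\<lambda>l\<in>{..<m}. Y l \<omega>) i) \<in> borel_measurable M"
    using assms(3)
    by (intro measurable_compose[OF measurable_compose[OF measurable_sample_vec[OF assms(1,2)]
          measurable_sort_vec] measurable_component_singleton]) auto
  moreover have "order_stat m Y i = (\<lambda>\<omega>. sort_vec m (\<lambda>l\<in>{..<m}. Y l \<omega>) i)"
    by (intro ext order_stat_eq_sort_vec assms(3))
  ultimately show ?thesis by simp
qed

text \<open>This joins the two sampling schemes. With n + 2 observations, the first of the n + 2 spacings
  comes from the transformed minimum alone and is dropped; with n + 1 observations and \<open>X 0\<close> at the left endpoint,
  the transformed minimum is itself the gap above \<open>X' 0 = 0\<close>. In both cases n + 1 independent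
  exponentials remain, with the same weights.\<close>

lemma normalized_spacings_of_cum_hazard:
  assumes M: "prob_space M" and F: "df_with_density F f"
    and X: "full_order_statistics M n f X \<or> endpoint_order_statistics M n F f X"
  obtains R where "R \<in> M \<rightarrow>\<^sub>M PiM {..<Suc n} (\<lambda>_. borel)"
    and "distr M (PiM {..<Suc n} (\<lambda>_. borel)) R = PiM {..<Suc n} (\<lambda>_. exp_law)"
    and "AE \<omega> in M. (\<forall>l\<le>n + 1. F (X l \<omega>) < 1) \<and>
      (\<forall>i<Suc n. R \<omega> i = norm_spacing n (\<lambda>l. cum_hazard F (X l \<omega>)) (Suc i))"
    and "\<And>l. l \<le> n + 1 \<Longrightarrow> X l \<in> borel_measurable M"
proof -
  interpret M: prob_space M by fact
  let ?\<mu> = "density lborel (\<lambda>x. ennreal (f x))"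
  define R where "R m Y \<omega> = spacing_vec m (sort_vec m (\<lambda>l\<in>{..<m}. cum_hazard F (Y l \<omega>)))"
    for m and Y :: "nat \<Rightarrow> 'a \<Rightarrow> real" and \<omega>
  have Rm: "R m Y \<in> M \<rightarrow>\<^sub>M PiM {..<m} (\<lambda>_. borel)"
    and Rd: "distr M (PiM {..<m} (\<lambda>_. borel)) (R m Y) = PiM {..<m} (\<lambda>_. exp_law)"
    if Y: "iid_sample M m ?\<mu> Y" for m Y
  proof -
    note E = iid_sample_cum_hazard[OF M F Y]
    note s = measurable_compose[OF measurable_sort_vec measurable_spacing_vec]
    show "R m Y \<in> M \<rightarrow>\<^sub>M PiM {..<m} (\<lambda>_. borel)"
      unfolding R_def[abs_def] by (rule measurable_compose[OF measurable_sample_vec[OF M E] s])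
    have "distr M (PiM {..<m} (\<lambda>_. borel)) (R m Y) =
      distr (distr M (PiM {..<m} (\<lambda>_. borel)) (\<lambda>\<omega>. \<lambda>l\<in>{..<m}. cum_hazard F (Y l \<omega>)))
        (PiM {..<m} (\<lambda>_. borel)) (\<lambda>x. spacing_vec m (sort_vec m x))"
      by (subst distr_distr[OF s measurable_sample_vec[OF M E]]) (simp add: R_def[abs_def] comp_def)
    then show "distr M (PiM {..<m} (\<lambda>_. borel)) (R m Y) = PiM {..<m} (\<lambda>_. exp_law)"
      by (simp only: distr_iid_sample[OF M E] distr_spacing_sort_vec_exp)
  qed
  have AE1: "AE \<omega> in M. \<forall>l<m. F (Y l \<omega>) < 1" if Y: "iid_sample M m ?\<mu> Y" for m Y
  proof -
    have "AE \<omega> in M. F (Y l \<omega>) < 1" if l: "l < m" for l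
    proof (rule AE_distrD[OF iid_sample_measurable[OF M Y l]])
      have eq: "distr M borel (Y l) = ?\<mu>" using Y l by (simp add: iid_sample_def)
      show "AE x in distr M borel (Y l). F x < 1" unfolding eq by (rule AE_df_less_1[OF F])
    qed
    then have "AE \<omega> in M. \<forall>l\<in>{..<m}. F (Y l \<omega>) < 1" by (intro AE_finite_allI) auto
    then show ?thesis by (simp add: Ball_def)
  qed
  from X show thesis
  proof
    assume "full_order_statistics M n f X"
    then obtain Y where Y: "iid_sample M (n + 2) ?\<mu> Y"
      and XY: "\<And>\<omega> i. \<omega> \<in> space M \<Longrightarrow> i \<le> n + 1 \<Longrightarrow> X i \<omega> = order_stat (n + 2) Y i \<omega>"
      unfolding full_order_statistics_def by blast
    let ?tail = "\<lambda>x. \<lambda>i\<in>{..<Suc n}. x (Suc i) :: real"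
    have tail: "?tail \<in> PiM {..<n + 2} (\<lambda>_. borel) \<rightarrow>\<^sub>M PiM {..<Suc n} (\<lambda>_. borel)"
      by (intro measurable_restrict measurable_component_singleton) auto
    show thesis
    proof (rule that[of "\<lambda>\<omega>. ?tail (R (n + 2) Y \<omega>)"])
      show "(\<lambda>\<omega>. ?tail (R (n + 2) Y \<omega>)) \<in> M \<rightarrow>\<^sub>M PiM {..<Suc n} (\<lambda>_. borel)"
        by (rule measurable_compose[OF Rm[OF Y] tail])
      have "distr M (PiM {..<Suc n} (\<lambda>_. borel)) (\<lambda>\<omega>. ?tail (R (n + 2) Y \<omega>))
        = distr (PiM {..<n + 2} (\<lambda>_. exp_law)) (PiM {..<Suc n} (\<lambda>_. borel)) ?tail"
        unfolding Rd[OF Y, symmetric] by (subst distr_distr[OF tail Rm[OF Y]]) (simp add: comp_def)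
      also have "\<dots> = distr (PiM {..<n + 2} (\<lambda>_. exp_law)) (PiM {..<Suc n} (\<lambda>_. exp_law)) ?tail"
        by (intro distr_cong refl sets_PiM_cong) simp_all
      also have "\<dots> = PiM {..<Suc n} (\<lambda>_. exp_law)"
        using distr_PiM_reindex[of "{..<n + 2}" "\<lambda>_. exp_law" Suc "{..<Suc n}"] prob_space_exp_law
        by (auto simp: inj_on_def)
      finally show "distr M (PiM {..<Suc n} (\<lambda>_. borel)) (\<lambda>\<omega>. ?tail (R (n + 2) Y \<omega>))
        = PiM {..<Suc n} (\<lambda>_. exp_law)" .
      show "AE \<omega> in M. (\<forall>l\<le>n + 1. F (X l \<omega>) < 1) \<and>
        (\<forall>i<Suc n. ?tail (R (n + 2) Y \<omega>) i = norm_spacing n (\<lambda>l. cum_hazard F (X l \<omega>)) (Suc i))"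
        using AE1[OF Y] AE_space
      proof eventually_elim
        case (elim \<omega>)
        have Xs: "X l \<omega> = sort (map (\<lambda>l. Y l \<omega>) [0..<n + 2]) ! l" if "l < n + 2" for l
          using XY[OF elim(2), of l] that by (simp add: order_stat_def del: upt_Suc)
        have c: "sort_vec (n + 2) (\<lambda>l\<in>{..<n + 2}. cum_hazard F (Y l \<omega>)) l = cum_hazard F (X l \<omega>)"
          and lt: "F (X l \<omega>) < 1" if "l < n + 2" for l
          using sort_vec_cum_hazard[OF F _ that, of "\<lambda>l. Y l \<omega>"] elim(1) Xs[OF that] by auto
        have "R (n + 2) Y \<omega> (Suc i) = norm_spacing n (\<lambda>l. cum_hazard F (X l \<omega>)) (Suc i)"
          if "i < Suc n" for i
          unfolding R_def spacing_vec_def norm_spacing_def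
          using that c[of "Suc i"] c[of i] by simp
        with lt show ?case by simp
      qed
      show "X l \<in> borel_measurable M" if "l \<le> n + 1" for l
        using measurable_order_stat[OF M Y, of l] that XY
        by (simp cong: measurable_cong)
    qed
  next
    assume "endpoint_order_statistics M n F f X"
    then obtain Y where Y: "iid_sample M (n + 1) ?\<mu> Y"
      and X0: "\<And>\<omega>. \<omega> \<in> space M \<Longrightarrow> X 0 \<omega> = left_endpoint F"
      and XY: "\<And>\<omega> i. \<omega> \<in> space M \<Longrightarrow> i \<in> {1..n + 1} \<Longrightarrow> X i \<omega> = order_stat (n + 1) Y (i - 1) \<omega>"
      unfolding endpoint_order_statistics_def by blast
    have Suc_n: "Suc n = n + 1" by simp
    show thesis
    proof (rule that[of "R (n + 1) Y"])
      show "R (n + 1) Y \<in> M \<rightarrow>\<^sub>M PiM {..<Suc n} (\<lambda>_. borel)"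
        unfolding Suc_n by (rule Rm[OF Y])
      show "distr M (PiM {..<Suc n} (\<lambda>_. borel)) (R (n + 1) Y) = PiM {..<Suc n} (\<lambda>_. exp_law)"
        unfolding Suc_n by (rule Rd[OF Y])
      show "AE \<omega> in M. (\<forall>l\<le>n + 1. F (X l \<omega>) < 1) \<and>
        (\<forall>i<Suc n. R (n + 1) Y \<omega> i = norm_spacing n (\<lambda>l. cum_hazard F (X l \<omega>)) (Suc i))"
        using AE1[OF Y] AE_space
      proof eventually_elim
        case (elim \<omega>)
        have Xs: "X (Suc l) \<omega> = sort (map (\<lambda>l. Y l \<omega>) [0..<n + 1]) ! l" if "l < n + 1" for l
          using XY[OF elim(2), of "Suc l"] that by (simp add: order_stat_def del: upt_Suc)
        have c: "sort_vec (n + 1) (\<lambda>l\<in>{..<n + 1}. cum_hazard F (Y l \<omega>)) l = cum_hazard F (X (Suc l) \<omega>)"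
          and lt: "F (X (Suc l) \<omega>) < 1" if "l < n + 1" for l
          using sort_vec_cum_hazard[OF F _ that, of "\<lambda>l. Y l \<omega>"] elim(1) Xs[OF that] by auto
        have c0: "cum_hazard F (X 0 \<omega>) = 0" and lt0: "F (X 0 \<omega>) < 1"
          using X0[OF elim(2)] df_left_endpoint[OF F] by (simp_all add: cum_hazard_def)
        have "F (X l \<omega>) < 1" if "l \<le> n + 1" for l
          using lt[of "l - 1"] lt0 that by (cases l) auto
        moreover have "R (n + 1) Y \<omega> i = norm_spacing n (\<lambda>l. cum_hazard F (X l \<omega>)) (Suc i)"
          if "i < Suc n" for i
        proof (cases i)
          case 0
          with c[of 0] c0 show ?thesis by (simp add: R_def spacing_vec_def norm_spacing_def)
        next
          case (Suc i')
          with that c[of i] c[of i'] show ?thesis by (simp add: R_def spacing_vec_def norm_spacing_def)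
        qed
        ultimately show ?case by blast
      qed
      show "X l \<in> borel_measurable M" if "l \<le> n + 1" for l
      proof (cases l)
        case 0
        then show ?thesis using X0 by (simp cong: measurable_cong)
      next
        case (Suc l')
        then show ?thesis
          using measurable_order_stat[OF M Y, of l'] that XY[of _ l] by (simp cong: measurable_cong)
      qed
    qed
  qed
qed

lemma AE_exp_law_pos:
  fixes m :: nat
  shows "AE x in PiM {..<m} (\<lambda>_. exp_law). \<forall>i<m. 0 < x i"
proof -
  have "AE x in exp_law. 0 < x"
    using AE_lborel_singleton[of "0::real"]
    by (subst AE_density) (auto elim!: eventually_mono simp: exponential_density_def)
  then have "AE x in PiM {..<m} (\<lambda>_. exp_law). 0 < x i" if "i < m" for i
    using that prob_space_exp_law by (intro AE_PiM_component) auto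
  then have "AE x in PiM {..<m} (\<lambda>_. exp_law). \<forall>i\<in>{..<m}. 0 < x i"
    by (intro AE_finite_allI) auto
  then show ?thesis by (simp add: Ball_def)
qed

text \<open>Both \<open>W'\<close> and U are determined by their n inner components, \<open>W'\<close> almost surely. Applying one
  map to both inner vectors carries an equality of their laws over to the full vectors.\<close>

definition fence :: "nat \<Rightarrow> (nat \<Rightarrow> real) \<Rightarrow> nat \<Rightarrow> real" where
  "fence n v = (\<lambda>i\<in>{0..n + 1}. if i = 0 then 0 else if i = n + 1 then 1 else v (i - 1))"

lemma measurable_fence: "fence n \<in> PiM {..<n} (\<lambda>_. borel) \<rightarrow>\<^sub>M PiM {0..n + 1} (\<lambda>_. borel)"
  unfolding fence_def[abs_def]
proof (rule measurable_restrict)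
  fix i assume i: "i \<in> {0..n + 1}"
  show "(\<lambda>v. if i = 0 then 0 else if i = n + 1 then 1 else v (i - 1)) \<in> borel_measurable (PiM {..<n} (\<lambda>_. borel))"
    using i by (cases "i = 0 \<or> i = n + 1") auto
qed

lemma norm_spacing_ratio_shift:
  assumes R: "\<And>i. i < Suc n \<Longrightarrow> R i = norm_spacing n x (Suc i)" and pos: "\<And>i. i < Suc n \<Longrightarrow> 0 < R i"
  shows "(\<lambda>i\<in>{0..n + 1}. norm_spacing_ratio n x i)
    = fence n (\<lambda>i\<in>{..<n}. (\<Sum>k\<le>i. R k) / (\<Sum>k\<le>n. R k))"
proof
  fix i
  have sum: "(\<Sum>k=1..Suc m. norm_spacing n x k) = (\<Sum>k\<le>m. R k)" if "m \<le> n" for m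
  proof -
    have "(\<Sum>k=1..Suc m. norm_spacing n x k) = (\<Sum>k=0..m. norm_spacing n x (Suc k))"
      using sum.shift_bounds_cl_Suc_ivl[of "norm_spacing n x" 0 m] by simp
    also have "\<dots> = (\<Sum>k\<le>m. R k)" using R that by (intro sum.cong) auto
    finally show ?thesis .
  qed
  have tot: "0 < (\<Sum>k\<le>n. R k)" using pos by (intro sum_pos) auto
  show "(\<lambda>i\<in>{0..n + 1}. norm_spacing_ratio n x i) i
    = fence n (\<lambda>i\<in>{..<n}. (\<Sum>k\<le>i. R k) / (\<Sum>k\<le>n. R k)) i"
  proof (cases i)
    case 0 then show ?thesis by (simp add: fence_def norm_spacing_ratio_def)
  next
    case (Suc m)
    consider "m < n" | "m = n" | "m > n" by linarith
    then show ?thesis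
      using tot sum[of m] sum[of n] Suc
      by cases (simp_all add: fence_def norm_spacing_ratio_def del: sum.cl_ivl_Suc)
  qed
qed

section \<open>Law and comparison of the normalized spacings\<close>

theorem proposition5p1:
  fixes M :: "'a measure" and N :: "'b measure"
    and F f :: "real \<Rightarrow> real" and n :: nat
    and X X' W W' :: "nat \<Rightarrow> 'a \<Rightarrow> real" and U :: "nat \<Rightarrow> 'b \<Rightarrow> real"
  assumes "prob_space M" and "prob_space N"
    and "df_with_density F f"
    and "full_order_statistics M n f X \<or> endpoint_order_statistics M n F f X"
    and "uniform_order_vector N n U"
    and "\<And>i \<omega>. X' i \<omega> = - ln (1 - F (X i \<omega>))"
    and "\<And>i \<omega>. W i \<omega> = norm_spacing_ratio n (\<lambda>l. X l \<omega>) i"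
    and "\<And>i \<omega>. W' i \<omega> = norm_spacing_ratio n (\<lambda>l. X' l \<omega>) i"
  shows "eq_in_law {0..n + 1} M W' N U \<and>
    (AE \<omega> in M. \<forall>j k. j < k \<longrightarrow> k \<le> n + 1 \<longrightarrow> k - j > 1 \<longrightarrow>
       (mono_on {X j \<omega><..<X k \<omega>} (failure_rate F f) \<longrightarrow>
          T_stat j k (\<lambda>i. W i \<omega>) \<ge> T_stat j k (\<lambda>i. W' i \<omega>)) \<and>
       (antimono_on {X j \<omega><..<X k \<omega>} (failure_rate F f) \<longrightarrow>
          T_stat j k (\<lambda>i. W i \<omega>) \<le> T_stat j k (\<lambda>i. W' i \<omega>)))"
proof
  note F = assms(3)
  let ?c = "\<lambda>\<omega> l. cum_hazard F (X l \<omega>)"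
  have X': "X' l \<omega> = ?c \<omega> l" for l \<omega> by (simp add: assms(6) cum_hazard_def)
  obtain R where Rm: "R \<in> M \<rightarrow>\<^sub>M PiM {..<Suc n} (\<lambda>_. borel)"
    and Rd: "distr M (PiM {..<Suc n} (\<lambda>_. borel)) R = PiM {..<Suc n} (\<lambda>_. exp_law)"
    and R: "AE \<omega> in M. (\<forall>l\<le>n + 1. F (X l \<omega>) < 1) \<and>
      (\<forall>i<Suc n. R \<omega> i = norm_spacing n (?c \<omega>) (Suc i))"
    and Xm: "\<And>l. l \<le> n + 1 \<Longrightarrow> X l \<in> borel_measurable M"
    by (rule normalized_spacings_of_cum_hazard[OF assms(1,3,4)]) (rule that)
  have pos: "AE \<omega> in M. \<forall>i<Suc n. 0 < R \<omega> i"
    using AE_exp_law_pos[of "Suc n"] unfolding Rd[symmetric] by (rule AE_distrD[OF Rm])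
  have law: "W' i = (\<lambda>\<omega>. norm_spacing_ratio n (?c \<omega>) i)" for i
    by (simp add: assms(8) X' fun_eq_iff)

  show "eq_in_law {0..n + 1} M W' N U"
  proof -
    let ?P = "PiM {..<n} (\<lambda>_. borel) :: (nat \<Rightarrow> real) measure"
    let ?Q = "PiM {0..n + 1} (\<lambda>_. borel) :: (nat \<Rightarrow> real) measure"
    let ?r = "\<lambda>d. \<lambda>i\<in>{..<n}. (\<Sum>k\<le>i. d k) / (\<Sum>k\<le>n. d k) :: real"
    have r: "?r \<in> PiM {..<Suc n} (\<lambda>_. borel) \<rightarrow>\<^sub>M ?P"
      by (intro measurable_restrict borel_measurable_divide borel_measurable_sum
          measurable_component_singleton) auto
    have cm: "(\<lambda>\<omega>. ?c \<omega> l) \<in> borel_measurable M" if "l \<le> n + 1" for l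
      by (rule measurable_compose[OF Xm[OF that] borel_measurable_cum_hazard[OF F]])
    have W'm: "W' i \<in> borel_measurable M" if "i \<in> {0..n + 1}" for i
      unfolding law norm_spacing_ratio_def norm_spacing_def
      using that by (intro borel_measurable_divide borel_measurable_sum borel_measurable_times
          borel_measurable_diff cm borel_measurable_const) auto
    obtain V where V: "iid_sample N n unif_law V"
      and UV: "\<And>\<omega>. \<omega> \<in> space N \<Longrightarrow> U 0 \<omega> = 0 \<and> U (n + 1) \<omega> = 1 \<and>
         (\<forall>i\<in>{1..n}. U i \<omega> = order_stat n V (i - 1) \<omega>)"
      using assms(5) unfolding uniform_order_vector_def by blast
    note Vm = measurable_sample_vec[OF assms(2) V]
    have U: "(\<lambda>i\<in>{0..n + 1}. U i \<omega>) = fence n (sort_vec n (\<lambda>l\<in>{..<n}. V l \<omega>))" if "\<omega> \<in> space N" for \<omega>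
      using UV[OF that] order_stat_eq_sort_vec[of _ n V \<omega>] by (auto simp: fence_def fun_eq_iff)
    have fsV: "(\<lambda>\<omega>. fence n (sort_vec n (\<lambda>l\<in>{..<n}. V l \<omega>))) \<in> N \<rightarrow>\<^sub>M ?Q"
      by (rule measurable_compose[OF measurable_compose[OF Vm measurable_sort_vec] measurable_fence])
    have Um: "U i \<in> borel_measurable N" if "i \<in> {0..n + 1}" for i
    proof (rule measurable_cong[THEN iffD1])
      show "(\<lambda>\<omega>. fence n (sort_vec n (\<lambda>l\<in>{..<n}. V l \<omega>)) i) \<in> borel_measurable N"
        by (rule measurable_compose[OF fsV measurable_component_singleton[OF that]])
      show "fence n (sort_vec n (\<lambda>l\<in>{..<n}. V l \<omega>)) i = U i \<omega>" if "\<omega> \<in> space N" for \<omega>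
        using U[OF that] \<open>i \<in> {0..n + 1}\<close> by (metis restrict_apply')
    qed
    have frR: "(\<lambda>\<omega>. fence n (?r (R \<omega>))) \<in> M \<rightarrow>\<^sub>M ?Q"
      by (rule measurable_compose[OF measurable_compose[OF Rm r] measurable_fence])
    have "distr M ?Q (\<lambda>\<omega>. \<lambda>i\<in>{0..n + 1}. W' i \<omega>) = distr M ?Q (\<lambda>\<omega>. fence n (?r (R \<omega>)))"
    proof (rule distr_cong_AE[OF refl refl])
      show "(\<lambda>\<omega>. \<lambda>i\<in>{0..n + 1}. W' i \<omega>) \<in> M \<rightarrow>\<^sub>M ?Q" by (intro measurable_restrict W'm)
      show "AE \<omega> in M. (\<lambda>i\<in>{0..n + 1}. W' i \<omega>) = fence n (?r (R \<omega>))"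
        using R pos
      proof eventually_elim
        case (elim \<omega>)
        then show ?case unfolding law by (intro norm_spacing_ratio_shift) auto
      qed
    qed (rule frR)
    also have "\<dots> = distr (distr (PiM {..<Suc n} (\<lambda>_. exp_law)) ?P ?r) ?Q (fence n)"
      unfolding Rd[symmetric]
      by (simp only: distr_distr[OF r Rm] comp_def
          distr_distr[OF measurable_fence measurable_compose[OF Rm r]])
    also have "\<dots> = distr (distr (PiM {..<n} (\<lambda>_. unif_law)) ?P (sort_vec n)) ?Q (fence n)"
      by (simp only: distr_partial_sum_ratios_exp)
    also have "\<dots> = distr N ?Q (\<lambda>\<omega>. fence n (sort_vec n (\<lambda>l\<in>{..<n}. V l \<omega>)))"
      unfolding distr_iid_sample[OF assms(2) V, symmetric]
      by (simp only: distr_distr[OF measurable_sort_vec Vm] comp_def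
          distr_distr[OF measurable_fence measurable_compose[OF Vm measurable_sort_vec]])
    also have "\<dots> = distr N ?Q (\<lambda>\<omega>. \<lambda>i\<in>{0..n + 1}. U i \<omega>)"
      by (intro distr_cong refl) (simp only: U)
    finally show ?thesis unfolding eq_in_law_def using W'm Um by blast
  qed

  show "AE \<omega> in M. \<forall>j k. j < k \<longrightarrow> k \<le> n + 1 \<longrightarrow> k - j > 1 \<longrightarrow>
       (mono_on {X j \<omega><..<X k \<omega>} (failure_rate F f) \<longrightarrow>
          T_stat j k (\<lambda>i. W i \<omega>) \<ge> T_stat j k (\<lambda>i. W' i \<omega>)) \<and>
       (antimono_on {X j \<omega><..<X k \<omega>} (failure_rate F f) \<longrightarrow>
          T_stat j k (\<lambda>i. W i \<omega>) \<le> T_stat j k (\<lambda>i. W' i \<omega>))"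
    using R pos
  proof eventually_elim
    case (elim \<omega>)
    have lt1: "F (X l \<omega>) < 1" if "l \<le> n + 1" for l using elim(1) that by blast
    have incr: "?c \<omega> l < ?c \<omega> (Suc l)" if "l \<le> n" for l
    proof -
      have "0 < norm_spacing n (?c \<omega>) (Suc l)" using elim that by (metis le_imp_less_Suc)
      then show ?thesis using that by (simp add: norm_spacing_def zero_less_mult_iff)
    qed
    have W: "(\<lambda>i. W i \<omega>) = norm_spacing_ratio n (\<lambda>l. X l \<omega>)"
      and W': "(\<lambda>i. W' i \<omega>) = norm_spacing_ratio n (?c \<omega>)"
      by (simp_all add: assms(7) law)
    show ?case
      unfolding W W'
      using T_stat_compare_cum_hazard[OF F, of _ _ n "\<lambda>l. X l \<omega>"] lt1 incr by blast
  qed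
qed

end
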